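(* Let $F(x)=x^4+ax^3+bx+c\in\mathbb{Z}[x]$ be irreducible over $\mathbb{Q}$, $\alpha$ a root of $F$ and $K=\mathbb{Q}(\alpha)$. Let $\mu=\nu_3(1-a-b+c)$, $\nu=\nu_3(-4+3a+b)$, $\omega=\nu_3(1+a+b+c)$ and $\tau=\nu_3(4+3a+b)$. Suppose one of the following holds: (1) $a\equiv\pm1\pmod3$, $b\equiv c\equiv0\pmod3$, $3\nu_3(b)<2\nu_3(c)$, $\nu_3(b)$ is even and $b_3\equiv-a\pmod3$; (2) $(a,b)\in\{(0,4),(3,22),(6,13),(9,4),(12,22),(15,13),(18,4),(21,22),(24,13)\}\pmod{27}$, $a+b\equiv1+c\pmod{243}$, and either (i) $2\nu<\mu+1$, or (ii) $2\nu>\mu+1$, $\mu$ is odd and $(1-a-b+c)_3\equiv1\pmod3$; (3) $(a,b)\in\{(0,23),(3,14),(6,5),(9,23),(12,14),(15,5),(18,23),(21,14),(24,5)\}\pmod{243}$, $a+b\equiv-(1+c)\pmod{243}$, and either (i) $2\tau<\omega+1$, or (ii) $2\tau>\omega+1$, $\omega$ is odd and $(1+a+b+c)_3\equiv1\pmod3$; (4) $(a,b)\in\{(2,16),(5,7),(8,25),(11,16),(14,7),(17,25),(20,16),(23,7),(26,25)\}\pmod{27}$ and $a+b\equiv c+1\pmod{81}$. Then $3$ is a common index divisor of $K$, and $\nu_3(i(K))=1$. In particular, $K$ is not monogenic.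
   Context: For a prime $p$ and a nonzero integer $m$, $\nu_p(m)$ is the $p$-adic valuation and $m_p:=m/p^{\nu_p(m)}$. Pairs congruent "mod $n$" to a listed set means componentwise congruence to one of the listed pairs. For a number field $K$ with ring of integers $\mathcal{O}_K$, $i(K)=\gcd\{[\mathcal{O}_K:\mathbb{Z}[\theta]]:\theta\in\mathcal{O}_K,\ K=\mathbb{Q}(\theta)\}$; a prime dividing $i(K)$ is a common index divisor of $K$. $K$ is monogenic if $\mathcal{O}_K=\mathbb{Z}[\theta]$ for some $\theta\in\mathcal{O}_K$. *)

theory Defs
  imports Complex_Main "HOL-Computational_Algebra.Computational_Algebra" "HOL-Number_Theory.Cong"
begin

definition field_gen :: "complex \<Rightarrow> complex set" where
  "field_gen \<alpha> = {poly (map_poly of_rat p) \<alpha> | p :: rat poly. True}"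

definition ring_of_integers :: "complex \<Rightarrow> complex set" where
  "ring_of_integers \<alpha> = {x \<in> field_gen \<alpha>. algebraic_int x}"

definition Zring :: "complex \<Rightarrow> complex set" where
  "Zring \<theta> = {poly (map_poly of_int p) \<theta> | p :: int poly. True}"

definition ring_index :: "complex \<Rightarrow> complex \<Rightarrow> nat" where
  "ring_index \<alpha> \<theta> = card (ring_of_integers \<alpha> //
      {(x, y). x \<in> ring_of_integers \<alpha> \<and> y \<in> ring_of_integers \<alpha> \<and> x - y \<in> Zring \<theta>})"

definition common_index :: "complex \<Rightarrow> nat" where
  "common_index \<alpha> = Gcd {ring_index \<alpha> \<theta> | \<theta>.
      \<theta> \<in> ring_of_integers \<alpha> \<and> field_gen \<theta> = field_gen \<alpha>}"

definition monogenic :: "complex \<Rightarrow> bool" where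
  "monogenic \<alpha> \<longleftrightarrow> (\<exists>\<theta> \<in> ring_of_integers \<alpha>.
      field_gen \<theta> = field_gen \<alpha> \<and> ring_of_integers \<alpha> = Zring \<theta>)"

definition nu3 :: "int \<Rightarrow> nat" where
  "nu3 m = multiplicity (3::int) m"

definition part3 :: "int \<Rightarrow> int" where
  "part3 m = m div 3 ^ nu3 m"

end

theory Submission
  imports Defs "HOL-Algebra.Sylow" "HOL-Computational_Algebra.Field_as_Ring"
    "Jordan_Normal_Form.Char_Poly"
begin

text \<open>
  In each of the four cases \<open>F\<close> splits into linear factors over the 3-adic integers: substitutions
  \<open>x = x\<^sub>0 + 3\<^sup>h z\<close> read off from the Newton polygon separate its roots, and Hensel's lemma lifts them.
  Instead of 3-adic numbers we use four integers \<open>r\<^sub>i\<close> that are roots of \<open>F\<close> modulo a high power of 3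
  and lie at a fixed 3-adic distance from each other. Their Lagrange polynomials, evaluated at \<open>\<alpha>\<close>,
  are algebraic integers \<open>E\<^sub>i\<close> that are orthogonal idempotents modulo \<open>9O\<close>, where \<open>O\<close> is the ring of integers
  of \<open>K\<close>. They form a basis of \<open>O/3O\<close>, so \<open>O\<close> has four residue maps to the field with three elements.
  By pigeonhole two of them agree at a given \<open>\<theta>\<close>, hence on \<open>\<int>[\<theta>]\<close>, which therefore lies in a subgroup of
  index 3. For \<open>\<theta> = E\<^sub>1 - E\<^sub>2 + 3E\<^sub>3\<close> this subgroup \<open>H\<close> satisfies \<open>H = \<int>[\<theta>] + 3H\<close>, so the index
  of \<open>\<int>[\<theta>]\<close> is exactly divisible by 3.
\<close>

section \<open>The ring of algebraic integers\<close>

text \<open>The ring O is never computed. In place of an integral basis there is one nonzero integer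
  D with D*O inside Z[\<alpha>]. The precision of the approximate roots is chosen beyond the power
  of 3 in D, which keeps the E_i out of 3O; orthogonal idempotents that are nonzero modulo 3 are
  independent, hence a rational basis of a field of degree four. Dividing by differences of the r_i
  costs a power of 3, so their distance must be bounded independently of the precision.

  The modulus 9 is dictated by \<theta>. Four residues in a field with three elements must collide,
  so \<theta> is chosen with residues 0, 1, -1, 0, where only the outer two collide; the term 3E_3
  separates these two modulo 9, and the collision costs a single factor 3.

  In HOL an infinite set has cardinality 0, so an infinite index would be divisible by 3 but have
  multiplicity 0. The exact power of 3 therefore requires that Z[\<theta>] has finite index in O,
  which D yields as well.\<close>

definition int_span :: "nat \<Rightarrow> (nat \<Rightarrow> complex) \<Rightarrow> complex set" where
  "int_span n v = {(\<Sum>k<n. of_int (c k) * v k) | c :: nat \<Rightarrow> int. True}"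

lemma int_span_base: "k < n \<Longrightarrow> v k \<in> int_span n v"
  unfolding int_span_def
  by (intro CollectI exI[of _ "\<lambda>i. if i = k then 1 else 0"])
     (auto simp: if_distrib[of of_int] if_distrib[of "\<lambda>x. x * _"] sum.delta cong: if_cong)

lemma int_span_0: "0 \<in> int_span n v"
  unfolding int_span_def by (intro CollectI exI[of _ "\<lambda>_. 0"]) auto

lemma int_span_add: "x \<in> int_span n v \<Longrightarrow> y \<in> int_span n v \<Longrightarrow> x + y \<in> int_span n v"
proof -
  assume "x \<in> int_span n v" "y \<in> int_span n v"
  then obtain c d :: "nat \<Rightarrow> int"
    where "x = (\<Sum>k<n. of_int (c k) * v k)" "y = (\<Sum>k<n. of_int (d k) * v k)"
    by (auto simp: int_span_def)
  then have "x + y = (\<Sum>k<n. of_int (c k + d k) * v k)"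
    by (simp add: algebra_simps sum.distrib)
  then show ?thesis
    unfolding int_span_def by (intro CollectI exI[of _ "\<lambda>k. c k + d k"]) simp
qed

lemma int_span_scale: "x \<in> int_span n v \<Longrightarrow> of_int m * x \<in> int_span n v"
proof -
  assume "x \<in> int_span n v"
  then obtain c :: "nat \<Rightarrow> int" where "x = (\<Sum>k<n. of_int (c k) * v k)"
    by (auto simp: int_span_def)
  then have "of_int m * x = (\<Sum>k<n. of_int (m * c k) * v k)"
    by (simp add: sum_distrib_left mult.assoc)
  then show ?thesis
    unfolding int_span_def by (intro CollectI exI[of _ "\<lambda>k. m * c k"]) simp
qed

lemma int_span_sum:
  "(\<And>i. i \<in> A \<Longrightarrow> f i \<in> int_span n v) \<Longrightarrow> sum f A \<in> int_span n v"
  by (induction A rule: infinite_finite_induct) (auto intro: int_span_0 int_span_add)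

lemma int_span_mult_closed:
  assumes "\<And>k. k < n \<Longrightarrow> x * v k \<in> int_span n v" and "y \<in> int_span n v"
  shows "x * y \<in> int_span n v"
proof -
  obtain c :: "nat \<Rightarrow> int" where "y = (\<Sum>k<n. of_int (c k) * v k)"
    using assms(2) by (auto simp: int_span_def)
  then have "x * y = (\<Sum>k<n. of_int (c k) * (x * v k))"
    by (simp add: sum_distrib_left mult_ac)
  also have "\<dots> \<in> int_span n v"
    by (intro int_span_sum int_span_scale assms) auto
  finally show ?thesis .
qed

text \<open>The relations make the vector of all \<open>v k\<close>, nonzero because of
  \<open>k0\<close>, an eigenvector of an integer matrix with eigenvalue \<open>x\<close>; the
  characteristic polynomial of that matrix is monic with integer coefficients.\<close>

lemma algebraic_int_if_span_invariant:
  assumes "\<And>k. k < n \<Longrightarrow> x * v k \<in> int_span n v" and "k0 < n" and "v k0 \<noteq> 0"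
  shows "algebraic_int x"
proof -
  have "\<exists>c :: nat \<Rightarrow> int. x * v k = (\<Sum>j<n. of_int (c j) * v j)" if "k < n" for k
    using assms(1)[OF that] by (auto simp: int_span_def)
  then obtain M :: "nat \<Rightarrow> nat \<Rightarrow> int"
    where M: "x * v k = (\<Sum>j<n. of_int (M k j) * v j)" if "k < n" for k
    by metis
  define A where "A = mat n n (\<lambda>(i, j). M i j)"
  define B where "B = map_mat (of_int :: int \<Rightarrow> complex) A"
  have A: "A \<in> carrier_mat n n"
    by (simp add: A_def)
  have B: "B \<in> carrier_mat n n"
    by (simp add: A_def B_def)
  have "B *\<^sub>v vec n v = x \<cdot>\<^sub>v vec n v"
    by (rule eq_vecI)
       (auto simp: B_def A_def scalar_prod_def M atLeast0LessThan)
  moreover have "vec n v \<noteq> 0\<^sub>v n"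
    using assms(2,3) by (metis index_vec index_zero_vec(1))
  ultimately have "eigenvalue B x"
    using B unfolding eigenvalue_def eigenvector_def by (intro exI[of _ "vec n v"]) auto
  then have "poly (char_poly B) x = 0"
    using eigenvalue_root_char_poly[OF B] by simp
  moreover have "char_poly B = map_poly of_int (char_poly A)"
    unfolding B_def by (rule of_int_hom.char_poly_hom[OF A])
  ultimately show ?thesis
    using degree_monic_char_poly[OF A] by (auto simp: algebraic_int_altdef_ipoly)
qed

text \<open>The span of the monomials \<open>x ^ i * y ^ j\<close> below the degrees of two monic
  equations is stable under both numbers, because \<open>x ^ n\<close> and \<open>y ^ m\<close>
  reduce to lower powers. Sums and products of \<open>x\<close> and \<open>y\<close> inherit this
  stability and hence integrality.\<close>

lemma common_int_span:
  assumes "algebraic_int (x :: complex)" and "algebraic_int y"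
  obtains n v k0 where "\<And>k. k < n \<Longrightarrow> x * v k \<in> int_span n v"
    and "\<And>k. k < n \<Longrightarrow> y * v k \<in> int_span n v" and "k0 < n" and "v k0 \<noteq> 0"
proof -
  obtain p where p: "poly (map_poly of_int p) x = 0" "lead_coeff p = 1"
    using assms(1) by (auto simp: algebraic_int_altdef_ipoly)
  obtain q where q: "poly (map_poly of_int q) y = 0" "lead_coeff q = 1"
    using assms(2) by (auto simp: algebraic_int_altdef_ipoly)
  define n m where "n = degree p" and "m = degree q"
  have n0: "n \<noteq> 0"
  proof
    assume "n = 0"
    then have "p = 1" using p(2) by (simp add: n_def monic_degree_0)
    then show False using p(1) by simp
  qed
  have m0: "m \<noteq> 0"
  proof
    assume "m = 0"
    then have "q = 1" using q(2) by (simp add: m_def monic_degree_0)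
    then show False using q(1) by simp
  qed
  \<comment> \<open>The index \<open>k\<close> encodes the pair of exponents \<open>k div m\<close>
    and \<open>k mod m\<close>.\<close>
  define v where "v k = x ^ (k div m) * y ^ (k mod m)" for k
  let ?S = "int_span (n * m) v"
  have base: "x ^ i * y ^ j \<in> ?S" if "i < n" "j < m" for i j
  proof -
    have "i * m + j < n * m"
      using mult_le_mono1[of "Suc i" n m] that by simp
    then have "v (i * m + j) \<in> ?S"
      by (rule int_span_base)
    then show ?thesis
      using that by (simp add: v_def)
  qed
  have xn: "x ^ n = (\<Sum>i<n. of_int (- coeff p i) * x ^ i)"
    using p by (simp add: poly_altdef n_def lessThan_Suc_atMost[symmetric] sum_negf add_eq_0_iff)
  have ym: "y ^ m = (\<Sum>i<m. of_int (- coeff q i) * y ^ i)"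
    using q by (simp add: poly_altdef m_def lessThan_Suc_atMost[symmetric] sum_negf add_eq_0_iff)
  have "x * v k \<in> ?S" if "k < n * m" for k
  proof -
    have k: "k div m < n" "k mod m < m"
      using that m0 by (auto simp: less_mult_imp_div_less)
    show ?thesis
    proof (cases "Suc (k div m) < n")
      case True
      then show ?thesis using base[OF True k(2)] by (simp add: v_def mult.assoc)
    next
      case False
      then have "Suc (k div m) = n" using k by simp
      then have "x * v k = x ^ n * y ^ (k mod m)"
        by (metis (no_types) v_def mult.assoc power_Suc)
      also have "\<dots> = (\<Sum>i<n. of_int (- coeff p i) * (x ^ i * y ^ (k mod m)))"
        by (simp only: xn sum_distrib_right mult.assoc)
      also have "\<dots> \<in> ?S"
        by (intro int_span_sum int_span_scale base k(2)) auto
      finally show ?thesis .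
    qed
  qed
  moreover have "y * v k \<in> ?S" if "k < n * m" for k
  proof -
    have k: "k div m < n" "k mod m < m"
      using that m0 by (auto simp: less_mult_imp_div_less)
    show ?thesis
    proof (cases "Suc (k mod m) < m")
      case True
      then show ?thesis using base[OF k(1) True] by (simp add: v_def mult_ac)
    next
      case False
      then have "Suc (k mod m) = m" using k by simp
      then have "y * v k = x ^ (k div m) * y ^ m"
        by (metis (no_types) v_def mult.left_commute power_Suc)
      also have "\<dots> = (\<Sum>i<m. of_int (- coeff q i) * (x ^ (k div m) * y ^ i))"
        by (simp only: ym sum_distrib_left mult_ac)
      also have "\<dots> \<in> ?S"
        by (intro int_span_sum int_span_scale base k(1)) auto
      finally show ?thesis .
    qed
  qed
  moreover have "0 < n * m" "v 0 \<noteq> 0"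
    using n0 m0 by (auto simp: v_def)
  ultimately show ?thesis
    using that by blast
qed

lemma algebraic_int_add:
  assumes "algebraic_int (x :: complex)" and "algebraic_int y"
  shows "algebraic_int (x + y)"
proof -
  obtain n v k0 where "\<And>k. k < n \<Longrightarrow> x * v k \<in> int_span n v"
    and "\<And>k. k < n \<Longrightarrow> y * v k \<in> int_span n v" and "k0 < n" and "v k0 \<noteq> 0"
    using common_int_span[OF assms] by blast
  then show ?thesis
    by (intro algebraic_int_if_span_invariant[of n _ v k0])
       (simp_all add: distrib_right int_span_add)
qed

lemma algebraic_int_mult:
  assumes "algebraic_int (x :: complex)" and "algebraic_int y"
  shows "algebraic_int (x * y)"
proof -
  obtain n v k0 where "\<And>k. k < n \<Longrightarrow> x * v k \<in> int_span n v"
    and "\<And>k. k < n \<Longrightarrow> y * v k \<in> int_span n v" and "k0 < n" and "v k0 \<noteq> 0"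
    using common_int_span[OF assms] by blast
  then show ?thesis
    by (intro algebraic_int_if_span_invariant[of n _ v k0])
       (simp_all add: mult.assoc int_span_mult_closed)
qed

lemma algebraic_int_diff:
  "algebraic_int (x :: complex) \<Longrightarrow> algebraic_int y \<Longrightarrow> algebraic_int (x - y)"
  using algebraic_int_add[of x "- y"] by simp

lemma algebraic_int_power: "algebraic_int (x :: complex) \<Longrightarrow> algebraic_int (x ^ n)"
  by (induction n) (auto intro: algebraic_int_mult int_imp_algebraic_int)

section \<open>Indices of additive subgroups\<close>

definition add_subgroup :: "'a :: ab_group_add set \<Rightarrow> bool" where
  "add_subgroup A \<longleftrightarrow> 0 \<in> A \<and> (\<forall>x\<in>A. \<forall>y\<in>A. x - y \<in> A)"

lemma add_subgroupD:
  assumes "add_subgroup A"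
  shows "0 \<in> A" and "x \<in> A \<Longrightarrow> - x \<in> A" and "x \<in> A \<Longrightarrow> y \<in> A \<Longrightarrow> x - y \<in> A"
    and "x \<in> A \<Longrightarrow> y \<in> A \<Longrightarrow> x + y \<in> A"
proof -
  show *: "0 \<in> A" "x \<in> A \<Longrightarrow> y \<in> A \<Longrightarrow> x - y \<in> A" for x y
    using assms by (auto simp: add_subgroup_def)
  show **: "- x \<in> A" if "x \<in> A" for x
    using *(2)[OF *(1) that] by simp
  show "x \<in> A \<Longrightarrow> y \<in> A \<Longrightarrow> x + y \<in> A"
    using *(2)[OF _ **, of x y] by simp
qed

text \<open>Cosets are plain translated sets here, so that portions of a quotient can be shifted and
  counted by images. The next lemma ties this to the equivalence classes in
  \<open>ring_index\<close>.\<close>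

definition add_cosets :: "'a :: ab_group_add set \<Rightarrow> 'a set \<Rightarrow> 'a set set" where
  "add_cosets A C = (\<lambda>x. (+) x ` C) ` A"

lemma quotient_eq_add_cosets:
  assumes "add_subgroup A" and "add_subgroup C" and "C \<subseteq> A"
  shows "A // {(x, y). x \<in> A \<and> y \<in> A \<and> x - y \<in> C} = add_cosets A C"
proof -
  have "{(x, y). x \<in> A \<and> y \<in> A \<and> x - y \<in> C} `` {x} = (+) x ` C" if x: "x \<in> A" for x
  proof (intro equalityI subsetI)
    fix y assume "y \<in> {(x, y). x \<in> A \<and> y \<in> A \<and> x - y \<in> C} `` {x}"
    then have "x - y \<in> C" by auto
    then have "y - x \<in> C" using add_subgroupD(2)[OF assms(2), of "x - y"] by simp
    then show "y \<in> (+) x ` C" by (intro image_eqI[of _ _ "y - x"]) auto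
  next
    fix y assume "y \<in> (+) x ` C"
    then obtain z where "z \<in> C" "y = x + z" by auto
    then show "y \<in> {(x, y). x \<in> A \<and> y \<in> A \<and> x - y \<in> C} `` {x}"
      using x assms add_subgroupD(2)[OF assms(2), of z] add_subgroupD(4)[OF assms(1), of x z] by auto
  qed
  then show ?thesis
    by (auto simp: quotient_def add_cosets_def)
qed

lemma add_coset_eq_iff:
  assumes "add_subgroup C"
  shows "(+) x ` C = (+) y ` C \<longleftrightarrow> x - y \<in> C"
proof
  assume "(+) x ` C = (+) y ` C"
  moreover have "x \<in> (+) x ` C" using add_subgroupD(1)[OF assms] by force
  ultimately show "x - y \<in> C" by auto
next
  have *: "(+) x ` C \<subseteq> (+) y ` C" if "x - y \<in> C" for x y
  proof
    fix z assume "z \<in> (+) x ` C"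
    then obtain w where "w \<in> C" "z = x + w" by auto
    then show "z \<in> (+) y ` C"
      using add_subgroupD(4)[OF assms that, of w] by (intro image_eqI[of _ _ "x - y + w"]) auto
  qed
  assume "x - y \<in> C"
  then show "(+) x ` C = (+) y ` C"
    using *[of x y] *[of y x] add_subgroupD(2)[OF assms, of "x - y"] by auto
qed

text \<open>\<open>A\<close> is the disjoint union of \<open>H\<close> and its translates by
  \<open>e\<close> and \<open>e + e\<close>, and translation carries the cosets of \<open>C\<close>
  inside one part bijectively to those inside another. If there are infinitely many, both sides are
  0 by the convention for \<open>card\<close>.\<close>

lemma card_add_cosets_index_3:
  fixes e :: "'a :: ab_group_add"
  assumes A: "add_subgroup A" and H: "add_subgroup H" and C: "add_subgroup C"
    and sub: "C \<subseteq> H" "H \<subseteq> A" and e: "e \<in> A" "e \<notin> H" "e + e \<notin> H"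
    and cover: "\<And>x. x \<in> A \<Longrightarrow> x \<in> H \<or> x - e \<in> H \<or> x - (e + e) \<in> H"
  shows "card (add_cosets A C) = 3 * card (add_cosets H C)"
proof -
  define T where "T u = (\<lambda>x. (+) x ` C) ` ((+) u ` H)" for u
  have AU: "add_cosets A C = T 0 \<union> T e \<union> T (e + e)"
  proof -
    have "A = H \<union> (+) e ` H \<union> (+) (e + e) ` H"
    proof (intro equalityI subsetI)
      fix x assume "x \<in> A"
      then consider "x \<in> H" | "x - e \<in> H" | "x - (e + e) \<in> H"
        using cover by blast
      then show "x \<in> H \<union> (+) e ` H \<union> (+) (e + e) ` H"
      proof cases
        case 2
        then have "x \<in> (+) e ` H" by (intro image_eqI[of _ _ "x - e"]) auto
        then show ?thesis by blast
      next
        case 3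
        then have "x \<in> (+) (e + e) ` H" by (intro image_eqI[of _ _ "x - (e + e)"]) auto
        then show ?thesis by blast
      qed auto
    qed (use sub e add_subgroupD(4)[OF A] in auto)
    then show ?thesis
      by (simp add: add_cosets_def T_def image_Un)
  qed
  have T0: "T 0 = add_cosets H C"
    by (simp add: T_def add_cosets_def)
  have Tu: "T u = (`) ((+) u) ` T 0" for u
    by (simp add: T_def image_image add.assoc)
  have inj: "inj_on ((`) ((+) u)) S" for u :: 'a and S
    by (intro inj_onI) (simp add: inj_image_eq_iff)
  have cardT: "card (T u) = card (T 0)" for u
    by (subst Tu) (intro card_image inj)
  have finT: "finite (T u) \<longleftrightarrow> finite (T 0)" for u
    by (subst Tu) (intro finite_image_iff inj)
  have disj: "T u \<inter> T w = {}" if "u - w \<notin> H" for u w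
  proof (rule ccontr)
    assume "T u \<inter> T w \<noteq> {}"
    then obtain g h where gh: "g \<in> H" "h \<in> H" "(+) (u + g) ` C = (+) (w + h) ` C"
      unfolding T_def by blast
    then have "(u + g) - (w + h) \<in> H"
      using add_coset_eq_iff[OF C] sub by blast
    then have "(u + g) - (w + h) + (h - g) \<in> H"
      by (rule add_subgroupD(4)[OF H]) (intro add_subgroupD(3)[OF H] gh)
    then show False using that by (simp add: algebra_simps)
  qed
  have d: "T 0 \<inter> T e = {}" "T 0 \<inter> T (e + e) = {}" "T e \<inter> T (e + e) = {}"
    using disj[of e 0] disj[of "e + e" 0] disj[of "e + e" e] e(2,3) by auto
  show ?thesis
  proof (cases "finite (T 0)")
    case True
    then have fin: "finite (T u)" for u using finT[of u] by blast
    have "card (add_cosets A C) = card (T 0) + card (T e) + card (T (e + e))"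
      unfolding AU using d fin by (simp add: card_Un_disjoint Int_Un_distrib2)
    then show ?thesis using cardT[of e] cardT[of "e + e"] by (simp add: T0)
  next
    case False
    then show ?thesis
      unfolding AU using T0 by (metis card.infinite finite_Un mult_0_right)
  qed
qed

text \<open>By Cauchy's theorem, if 3 divided the order of the quotient, multiplication by 3 would have
  a kernel there and could not be surjective.\<close>
lemma not_3_dvd_card_add_cosets:
  fixes H C :: "'a :: ab_group_add set"
  assumes H: "add_subgroup H" and C: "add_subgroup C" and sub: "C \<subseteq> H"
    and fin: "finite (add_cosets H C)"
    and div: "\<And>x. x \<in> H \<Longrightarrow> \<exists>y\<in>H. x - (y + y + y) \<in> C"
  shows "\<not> 3 dvd card (add_cosets H C)"
proof
  assume dvd: "3 dvd card (add_cosets H C)"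
  define G where "G = \<lparr>carrier = H, monoid.mult = (+), one = (0 :: 'a)\<rparr>"
  have inv: "\<exists>y\<in>H. x + y = 0" if "x \<in> H" for x
    using add_subgroupD(2)[OF H that] by (intro bexI[of _ "- x"]) auto
  interpret G: comm_group G
    by (rule comm_groupI)
       (use add_subgroupD[OF H] in \<open>auto simp: G_def add_ac inv\<close>)
  have Csub: "subgroup C G"
  proof (rule G.subgroupI)
    fix x assume "x \<in> C"
    then show "inv\<^bsub>G\<^esub> x \<in> C"
      using sub add_subgroupD(2)[OF C] add_subgroupD(2)[OF H] G.inv_equality[of "- x" x]
      by (auto simp: G_def)
  qed (use sub add_subgroupD(1,4)[OF C] in \<open>auto simp: G_def\<close>)
  interpret N: normal C G
    using Csub by (rule G.subgroup_imp_normal)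
  define Q where "Q = G Mod C"
  interpret Q: comm_group Q
    unfolding Q_def by (rule G.abelian_FactGroup[OF Csub])
  have rc: "r_coset G C x = (+) x ` C" for x
    by (auto simp: r_coset_def G_def add_ac)
  have carr: "carrier Q = add_cosets H C"
    by (auto simp: Q_def carrier_FactGroup add_cosets_def rc) (auto simp: G_def)
  have pow3: "(+) x ` C [^]\<^bsub>Q\<^esub> (3 :: nat) = (+) (x + x + x) ` C" if "x \<in> H" for x
  proof -
    have "r_coset G C x [^]\<^bsub>Q\<^esub> (3 :: nat) = r_coset G C (x [^]\<^bsub>G\<^esub> (3 :: nat))"
      unfolding Q_def by (rule N.FactGroup_pow) (use that in \<open>auto simp: G_def\<close>)
    also have "x [^]\<^bsub>G\<^esub> (3 :: nat) = x + x + x"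
      using that by (simp add: eval_nat_numeral G_def)
    finally show ?thesis by (simp add: rc)
  qed
  have surj: "(\<lambda>q. q [^]\<^bsub>Q\<^esub> (3 :: nat)) ` carrier Q = carrier Q"
  proof (intro equalityI subsetI)
    fix q assume "q \<in> carrier Q"
    then obtain x where x: "x \<in> H" "q = (+) x ` C"
      by (auto simp: carr add_cosets_def)
    obtain y where y: "y \<in> H" "x - (y + y + y) \<in> C"
      using div[OF x(1)] by blast
    then have "q = (+) y ` C [^]\<^bsub>Q\<^esub> (3 :: nat)"
      using x by (simp add: pow3 add_coset_eq_iff[OF C])
    then show "q \<in> (\<lambda>q. q [^]\<^bsub>Q\<^esub> (3 :: nat)) ` carrier Q"
      using y by (auto simp: carr add_cosets_def)
  qed auto
  have finQ: "finite (carrier Q)"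
    using fin by (simp add: carr)
  have inj: "inj_on (\<lambda>q. q [^]\<^bsub>Q\<^esub> (3 :: nat)) (carrier Q)"
    by (rule eq_card_imp_inj_on) (simp_all add: finQ surj)
  \<comment> \<open>Sylow's theorem with exponent 1 is Cauchy's theorem: it gives a subgroup of
    order 3. Cubing in \<open>Q\<close> annihilates that subgroup, yet cubing is injective, being
    surjective on a finite set.\<close>
  obtain m where "order Q = 3 ^ 1 * m"
    using dvd by (auto simp: Coset.order_def carr)
  then obtain P where P: "subgroup P Q" "card P = 3 ^ 1"
    using sylow_thm[of 3 Q 1 m] finQ Q.is_group by auto
  have "P \<subseteq> {\<one>\<^bsub>Q\<^esub>}"
  proof
    fix q assume q: "q \<in> P"
    then have qQ: "q \<in> carrier Q"
      using P(1) by (meson subgroup.mem_carrier)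
    interpret P: comm_group "Q\<lparr>carrier := P\<rparr>"
      by (rule group.group_comm_groupI[OF subgroup.subgroup_is_group[OF P(1) Q.is_group]])
         (use P(1) Q.m_comm in \<open>auto dest: subgroup.mem_carrier\<close>)
    have "finite P" using P(2) card.infinite by fastforce
    then have "q [^]\<^bsub>Q\<lparr>carrier := P\<rparr>\<^esub> card P = \<one>\<^bsub>Q\<^esub>"
      using P.power_order_eq_one[of q] q by simp
    then have "q [^]\<^bsub>Q\<^esub> (3 :: nat) = \<one>\<^bsub>Q\<^esub>"
      using P(2) by (simp flip: Q.nat_pow_consistent)
    then have "q [^]\<^bsub>Q\<^esub> (3 :: nat) = \<one>\<^bsub>Q\<^esub> [^]\<^bsub>Q\<^esub> (3 :: nat)"
      by simp
    then have "q = \<one>\<^bsub>Q\<^esub>"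
      by (rule inj_onD[OF inj]) (use qQ in auto)
    then show "q \<in> {\<one>\<^bsub>Q\<^esub>}" by blast
  qed
  then have "card P \<le> 1"
    using card_mono[of "{\<one>\<^bsub>Q\<^esub>}" P] by simp
  then show False using P(2) by simp
qed

section \<open>Rings with four orthogonal idempotents modulo 9\<close>

lemma sum_lessThan_4: "(\<Sum>i<4. f i) = f 0 + f 1 + f 2 + f (3 :: nat)"
  by (simp add: eval_nat_numeral)

lemma int_comb_div_3:
  fixes v :: "nat \<Rightarrow> complex" and c :: "nat \<Rightarrow> int"
  assumes "\<And>i. i < n \<Longrightarrow> 3 dvd c i"
  shows "(\<Sum>i<n. of_int (c i) * v i) = 3 * (\<Sum>i<n. of_int (c i div 3) * v i)"
  unfolding sum_distrib_left
proof (rule sum.cong)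
  fix i assume "i \<in> {..<n}"
  then obtain k where "c i = 3 * k" using assms by blast
  then show "of_int (c i) * v i = 3 * (of_int (c i div 3) * v i)" by simp
qed auto

text \<open>Infinite descent: dividing all coefficients by 3 gives another relation, so each
  coefficient is divisible by every power of 3.\<close>

lemma int_relation_descent:
  fixes v :: "nat \<Rightarrow> complex" and c :: "nat \<Rightarrow> int"
  assumes desc: "\<And>c :: nat \<Rightarrow> int. (\<Sum>i<n. of_int (c i) * v i) = 0 \<Longrightarrow> \<forall>i<n. 3 dvd c i"
    and rel: "(\<Sum>i<n. of_int (c i) * v i) = 0" and i: "i < n"
  shows "c i = 0"
proof -
  have "\<exists>c'. (\<Sum>i<n. of_int (c' i) * v i) = 0 \<and> (\<forall>i<n. c i = 3 ^ k * c' i)" for k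
  proof (induction k)
    case 0
    then show ?case using rel by auto
  next
    case (Suc k)
    then obtain c' where c': "(\<Sum>i<n. of_int (c' i) * v i) = 0" "\<forall>i<n. c i = 3 ^ k * c' i"
      by blast
    have dv: "\<forall>i<n. c' i = 3 * (c' i div 3)"
      using desc[OF c'(1)] by auto
    have "(\<Sum>i<n. of_int (c' i) * v i) = 3 * (\<Sum>i<n. of_int (c' i div 3) * v i)"
      by (rule int_comb_div_3) (use desc[OF c'(1)] in blast)
    then show ?case
      using c' dv by (intro exI[of _ "\<lambda>i. c' i div 3"]) auto
  qed
  then have "\<forall>k. 3 ^ k dvd c i"
    using i by (metis dvd_triv_left)
  then have "3 ^ nat \<bar>c i\<bar> dvd c i" by blast
  moreover have "\<bar>c i\<bar> < 3 ^ nat \<bar>c i\<bar>"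
  proof -
    have "int (nat \<bar>c i\<bar>) < int (3 ^ nat \<bar>c i\<bar>)"
      by (subst of_nat_less_iff) (rule power_gt_expt, simp)
    then show ?thesis by (metis abs_ge_zero int_nat_eq of_nat_numeral of_nat_power)
  qed
  ultimately show ?thesis
    by (metis abs_ge_self dvd_imp_le_int linorder_not_less abs_of_nonneg zero_le_numeral zero_le_power)
qed

text \<open>Modulo 3 every unit is its own inverse, so \<open>u = k\<close> works.\<close>

lemma bezout_mod_3:
  fixes k :: int
  assumes "\<not> 3 dvd k"
  shows "\<exists>u v. k * u + 3 * v = 1"
proof -
  have "k * k mod 3 = 1"
    using assms mod_mult_eq[of k 3 k] by (cases "k mod 3 = 1"; cases "k mod 3 = 2") (auto simp: dvd_eq_mod_eq_0)
  then have "k * k + 3 * - (k * k div 3) = 1"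
    using div_mult_mod_eq[of "k * k" 3] by linarith
  then show ?thesis by blast
qed

lemma add_subgroup_Zring: "add_subgroup (Zring \<theta>)"
  unfolding add_subgroup_def Zring_def
proof (intro conjI ballI)
  show "0 \<in> {poly (map_poly of_int p) \<theta> | p :: int poly. True}"
    by (intro CollectI exI[of _ 0]) auto
  fix x y assume "x \<in> {poly (map_poly of_int p) \<theta> | p :: int poly. True}"
    "y \<in> {poly (map_poly of_int p) \<theta> | p :: int poly. True}"
  then obtain p q :: "int poly" where "x = poly (map_poly of_int p) \<theta>" "y = poly (map_poly of_int q) \<theta>"
    by auto
  then show "x - y \<in> {poly (map_poly of_int p) \<theta> | p :: int poly. True}"
    by (intro CollectI exI[of _ "p - q"]) (simp add: of_int_poly_hom.hom_minus)
qed

text \<open>\<open>R\<close> abstracts the ring of integers. No quotient ring is formed: congruences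
  are equations with a remainder in \<open>R\<close>. The last axiom says that \<open>E i\<close> is
  nonzero modulo 3.\<close>

locale idempotents_mod_9 =
  fixes R :: "complex set" and E :: "nat \<Rightarrow> complex"
  assumes one_closed: "1 \<in> R"
    and diff_closed: "x \<in> R \<Longrightarrow> y \<in> R \<Longrightarrow> x - y \<in> R"
    and mult_closed: "x \<in> R \<Longrightarrow> y \<in> R \<Longrightarrow> x * y \<in> R"
    and E_closed: "i < 4 \<Longrightarrow> E i \<in> R"
    and E_mult: "i < 4 \<Longrightarrow> j < 4 \<Longrightarrow> \<exists>z\<in>R. E i * E j = (if i = j then E i else 0) + 9 * z"
    and E_sum: "\<exists>z\<in>R. (\<Sum>i<4. E i) = 1 + 9 * z"
    and E_nontriv: "i < 4 \<Longrightarrow> z \<in> R \<Longrightarrow> E i \<noteq> 3 * z"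
begin

lemma zero_closed: "0 \<in> R"
  using diff_closed[OF one_closed one_closed] by simp

lemma uminus_closed: "x \<in> R \<Longrightarrow> - x \<in> R"
  using diff_closed[OF zero_closed] by fastforce

lemma add_closed: "x \<in> R \<Longrightarrow> y \<in> R \<Longrightarrow> x + y \<in> R"
  using diff_closed[OF _ uminus_closed, of x y] by simp

lemma of_int_closed: "of_int k \<in> R"
proof -
  have "of_nat n \<in> R" for n
    by (induction n) (auto intro: zero_closed one_closed add_closed)
  then show ?thesis
    by (cases k rule: int_cases2) (auto intro: uminus_closed)
qed

lemma numeral_closed: "numeral n \<in> R"
  using of_int_closed[of "numeral n"] by simp

lemmas closed = zero_closed one_closed uminus_closed add_closed diff_closed mult_closed
  of_int_closed numeral_closed E_closed

definition cg :: "int \<Rightarrow> complex \<Rightarrow> complex \<Rightarrow> bool" where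
  "cg m x y \<longleftrightarrow> (\<exists>z\<in>R. x = y + of_int m * z)"

lemma cgI: "x = y + of_int m * z \<Longrightarrow> z \<in> R \<Longrightarrow> cg m x y"
  by (auto simp: cg_def)

lemma cg_refl [simp]: "cg m x x"
  by (auto simp: cg_def intro: bexI[of _ 0] zero_closed)

lemma cg_sym: "cg m x y \<Longrightarrow> cg m y x"
proof -
  assume "cg m x y"
  then obtain z where "z \<in> R" "x = y + of_int m * z" by (auto simp: cg_def)
  then show ?thesis by (intro cgI[of _ _ _ "- z"]) (auto intro: uminus_closed)
qed

lemma cg_trans [trans]: "cg m x y \<Longrightarrow> cg m y z \<Longrightarrow> cg m x z"
proof -
  assume "cg m x y" "cg m y z"
  then obtain u v where "u \<in> R" "v \<in> R" "x = y + of_int m * u" "y = z + of_int m * v"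
    by (auto simp: cg_def)
  then show ?thesis by (intro cgI[of _ _ _ "u + v"]) (auto intro: add_closed simp: algebra_simps)
qed

lemma cg_add: "cg m x y \<Longrightarrow> cg m x' y' \<Longrightarrow> cg m (x + x') (y + y')"
proof -
  assume "cg m x y" "cg m x' y'"
  then obtain u v where "u \<in> R" "v \<in> R" "x = y + of_int m * u" "x' = y' + of_int m * v"
    by (auto simp: cg_def)
  then show ?thesis by (intro cgI[of _ _ _ "u + v"]) (auto intro: add_closed simp: algebra_simps)
qed

lemma cg_mult_left: "cg m x y \<Longrightarrow> a \<in> R \<Longrightarrow> cg m (a * x) (a * y)"
proof -
  assume "cg m x y" and a: "a \<in> R"
  then obtain u where "u \<in> R" "x = y + of_int m * u"
    by (auto simp: cg_def)
  then show ?thesis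
    using a by (intro cgI[of _ _ _ "a * u"]) (auto intro: mult_closed simp: algebra_simps)
qed

lemma cg_mult_right: "cg m x y \<Longrightarrow> a \<in> R \<Longrightarrow> cg m (x * a) (y * a)"
  using cg_mult_left[of m x y a] by (simp add: mult.commute)

lemma cg_diff: "cg m x y \<Longrightarrow> cg m x' y' \<Longrightarrow> cg m (x - x') (y - y')"
  using cg_add[of m x y "-1 * x'" "-1 * y'"] cg_mult_left[of m x' y' "-1"]
  by (auto intro: closed)

lemma cg_sum: "(\<And>i. i \<in> A \<Longrightarrow> cg m (f i) (g i)) \<Longrightarrow> cg m (sum f A) (sum g A)"
  by (induction A rule: infinite_finite_induct) (auto intro: cg_add)

lemma cg_9_3: "cg 9 x y \<Longrightarrow> cg 3 x y"
  by (auto simp: cg_def intro!: bexI[of _ "3 * _"] closed)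

lemma E_mult_cg: "i < 4 \<Longrightarrow> j < 4 \<Longrightarrow> cg 9 (E i * E j) (if i = j then E i else 0)"
  using E_mult[of i j] by (auto simp: cg_def)

text \<open>Orthogonality turns multiplication by \<open>E l\<close> into the projection to the
  \<open>l\<close>-th coordinate.\<close>

lemma E_comb:
  assumes "l < 4"
  shows "cg 9 (E l * (\<Sum>i<4. of_int (c i) * E i)) (of_int (c l) * E l)"
proof -
  have "cg 9 (\<Sum>i<4. of_int (c i) * (E l * E i)) (\<Sum>i<4. of_int (c i) * (if l = i then E l else 0))"
    by (intro cg_sum cg_mult_left E_mult_cg of_int_closed) (use assms in auto)
  also have "(\<Sum>i<4. of_int (c i) * (if l = i then E l else 0)) = of_int (c l) * E l"
    using assms by (simp add: if_distrib[of "\<lambda>x. _ * x"] sum.delta cong: if_cong)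
  finally show ?thesis
    by (simp add: sum_distrib_left mult_ac)
qed

text \<open>If \<open>k\<close> were a unit modulo 3, a Bezout relation would write
  \<open>E l\<close> itself as 3 times an element of \<open>R\<close>.\<close>

lemma scaled_E_cg_0_mod_3:
  assumes l: "l < 4" and "cg 3 (of_int k * E l) 0"
  shows "3 dvd k"
proof (rule ccontr)
  assume "\<not> 3 dvd k"
  then obtain u v where uv: "k * u + 3 * v = 1"
    using bezout_mod_3 by blast
  obtain z where z: "z \<in> R" "of_int k * E l = 3 * z"
    using assms(2) by (auto simp: cg_def)
  have "E l = of_int (k * u + 3 * v) * E l"
    by (simp only: uv of_int_1 mult_1_left)
  also have "\<dots> = of_int u * (of_int k * E l) + 3 * (of_int v * E l)"
    by (simp add: algebra_simps)
  also have "\<dots> = 3 * (of_int u * z + of_int v * E l)"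
    unfolding z by (simp add: algebra_simps)
  finally have "E l = 3 * (of_int u * z + of_int v * E l)" .
  then show False
    using E_nontriv[OF l, of "of_int u * z + of_int v * E l"] z(1) l by (simp add: closed)
qed

lemma scaled_E_cg_0_mod_9:
  assumes l: "l < 4" and "cg 9 (of_int k * E l) 0"
  shows "9 dvd k"
proof -
  have "3 dvd k"
    using scaled_E_cg_0_mod_3[OF l cg_9_3[OF assms(2)]] .
  then obtain k' where k': "k = 3 * k'" by blast
  obtain z where z: "z \<in> R" "of_int k * E l = 9 * z"
    using assms(2) by (auto simp: cg_def)
  \<comment> \<open>\<open>R\<close> consists of complex numbers, so a common factor 3 cancels and
    the statement modulo 3 applies a second time.\<close>
  then have "of_int k' * E l = 3 * z"
    by (simp add: k' algebra_simps)
  then have "3 dvd k'"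
    using scaled_E_cg_0_mod_3[OF l, of k'] z(1) by (auto simp: cg_def)
  then show ?thesis by (auto simp: k')
qed

lemma comb_cg_0:
  assumes "l < 4"
  shows "cg 3 (\<Sum>i<4. of_int (c i) * E i) 0 \<Longrightarrow> 3 dvd c l"
    and "cg 9 (\<Sum>i<4. of_int (c i) * E i) 0 \<Longrightarrow> 9 dvd c l"
proof -
  have *: "cg m (of_int (c l) * E l) 0"
    if "cg m (\<Sum>i<4. of_int (c i) * E i) 0" "cg m (E l * (\<Sum>i<4. of_int (c i) * E i)) (of_int (c l) * E l)" for m
    using cg_trans[OF cg_sym[OF that(2)] cg_mult_left[OF that(1) E_closed[OF assms]]] by simp
  show "cg 3 (\<Sum>i<4. of_int (c i) * E i) 0 \<Longrightarrow> 3 dvd c l"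
    using *[of 3] cg_9_3[OF E_comb[OF assms]] scaled_E_cg_0_mod_3[OF assms] by blast
  show "cg 9 (\<Sum>i<4. of_int (c i) * E i) 0 \<Longrightarrow> 9 dvd c l"
    using *[of 9] E_comb[OF assms] scaled_E_cg_0_mod_9[OF assms] by blast
qed

lemma E_independent:
  assumes "(\<Sum>i<4. of_int (c i) * E i) = 0" and "i < 4"
  shows "c i = 0"
  by (rule int_relation_descent[OF _ assms]) (auto intro!: comb_cg_0(1))

end

text \<open>Spanning is a separate axiom because it is established later by a dimension count that
  rests on \<open>E_independent\<close> from the smaller locale.\<close>

locale idempotent_basis_mod_9 = idempotents_mod_9 +
  assumes E_span: "x \<in> R \<Longrightarrow> \<exists>d c. d \<noteq> 0 \<and> of_int d * x = (\<Sum>i<4. of_int (c i) * E i)"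
begin

text \<open>The denominator \<open>d\<close> can be made prime to 3: if 3 divides it, the
  combination of the \<open>E i\<close> is divisible by 3, hence so is each coefficient, and a
  factor 3 cancels. Then \<open>d\<close> is invertible modulo 3.\<close>

lemma coords_mod_3:
  assumes x: "x \<in> R"
  obtains c :: "nat \<Rightarrow> int" where "cg 3 x (\<Sum>i<4. of_int (c i) * E i)"
proof -
  have "\<exists>d' c'. \<not> 3 dvd d' \<and> of_int d' * x = (\<Sum>i<4. of_int (c' i) * E i)"
    if "d \<noteq> 0" "of_int d * x = (\<Sum>i<4. of_int (c i) * E i)" for d :: int and c :: "nat \<Rightarrow> int"
    using that
  proof (induction "nat \<bar>d\<bar>" arbitrary: d c rule: less_induct)
    case less
    show ?case
    proof (cases "3 dvd d")
      case True
      then obtain d' where d': "d = 3 * d'" by blast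
      have "cg 3 (\<Sum>i<4. of_int (c i) * E i) 0"
        using less.prems x by (intro cgI[of _ _ _ "of_int d' * x"]) (auto simp: d' closed simp flip: less.prems(2))
      then have "(\<Sum>i<4. of_int (c i) * E i) = 3 * (\<Sum>i<4. of_int (c i div 3) * E i)"
        by (intro int_comb_div_3 comb_cg_0(1))
      then have "3 * (of_int d' * x) = 3 * (\<Sum>i<4. of_int (c i div 3) * E i)"
        using less.prems(2) by (simp add: d' mult.assoc)
      then have "of_int d' * x = (\<Sum>i<4. of_int (c i div 3) * E i)" by simp
      moreover have "d' \<noteq> 0" "nat \<bar>d'\<bar> < nat \<bar>d\<bar>" using less.prems(1) d' by auto
      ultimately show ?thesis using less.hyps[of d' "\<lambda>i. c i div 3"] by blast
    qed (use less.prems in blast)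
  qed
  then obtain d c where dc: "\<not> 3 dvd d" "of_int d * x = (\<Sum>i<4. of_int (c i) * E i)"
    using E_span[OF x] by blast
  obtain u v where uv: "d * u + 3 * v = 1"
    using bezout_mod_3[OF dc(1)] by blast
  have "x = of_int (d * u + 3 * v) * x"
    by (simp only: uv of_int_1 mult_1_left)
  also have "\<dots> = of_int u * (of_int d * x) + 3 * (of_int v * x)"
    by (simp add: algebra_simps)
  also have "of_int u * (of_int d * x) = (\<Sum>i<4. of_int (u * c i) * E i)"
    by (simp add: dc sum_distrib_left mult.assoc)
  finally have "cg 3 x (\<Sum>i<4. of_int (u * c i) * E i)"
    using x by (auto simp: cg_def closed)
  then show ?thesis by (rule that)
qed

text \<open>A ring homomorphism from \<open>R\<close> to the field with three elements, represented
  by 0, 1, 2. The integer found by \<open>SOME\<close> is determined only modulo 3, and the outer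
  \<open>mod 3\<close> removes the choice.\<close>

definition res :: "nat \<Rightarrow> complex \<Rightarrow> int" where
  "res l x = (SOME k. cg 3 (E l * x) (of_int k * E l)) mod 3"

lemma res_mod [simp]: "res l x mod 3 = res l x"
  by (simp add: res_def)

lemma res_range: "res l x \<in> {0, 1, 2}"
proof -
  have "0 \<le> res l x" "res l x < 3" by (auto simp: res_def)
  then show ?thesis by auto
qed

lemma res_unique:
  assumes l: "l < 4" and "cg 3 (E l * x) (of_int k * E l)"
  shows "res l x = k mod 3"
proof -
  define k' where "k' = (SOME k. cg 3 (E l * x) (of_int k * E l))"
  have k': "cg 3 (E l * x) (of_int k' * E l)"
    unfolding k'_def by (rule someI) (rule assms(2))
  have "cg 3 (of_int (k' - k) * E l) 0"
    using cg_diff[OF k' assms(2)] cg_sym by (fastforce simp: algebra_simps)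
  then have "3 dvd k' - k"
    by (rule scaled_E_cg_0_mod_3[OF l])
  then show ?thesis
    by (simp add: res_def k'_def mod_eq_dvd_iff)
qed

lemma res_comb:
  assumes "l < 4" and "cg 3 x (\<Sum>i<4. of_int (c i) * E i)"
  shows "res l x = c l mod 3"
  using cg_trans[OF cg_mult_left[OF assms(2) E_closed] cg_9_3[OF E_comb]] assms(1)
  by (intro res_unique) auto

lemma res_spec:
  assumes "x \<in> R" and "l < 4"
  shows "cg 3 (E l * x) (of_int (res l x) * E l)"
proof -
  obtain c where "cg 3 x (\<Sum>i<4. of_int (c i) * E i)"
    using coords_mod_3[OF assms(1)] by blast
  then have *: "cg 3 (E l * x) (of_int (c l) * E l)"
    using cg_trans[OF cg_mult_left[OF _ E_closed] cg_9_3[OF E_comb]] assms(2) by blast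
  have "c l mod 3 = res l x mod 3"
    using res_unique[OF assms(2) *] by simp
  then obtain k where "c l = res l x + 3 * k"
    by (metis mod_eqE mult.commute)
  then have "of_int (c l) * E l = of_int (res l x) * E l + 3 * (of_int k * E l)"
    by (simp add: algebra_simps)
  then have "cg 3 (of_int (c l) * E l) (of_int (res l x) * E l)"
    using assms(2) by (auto simp: cg_def closed)
  then show ?thesis by (rule cg_trans[OF *])
qed

lemma res_diff: "x \<in> R \<Longrightarrow> y \<in> R \<Longrightarrow> l < 4 \<Longrightarrow> res l (x - y) = (res l x - res l y) mod 3"
  using cg_diff[OF res_spec[of x l] res_spec[of y l]] by (intro res_unique) (auto simp: algebra_simps)

lemma res_add: "x \<in> R \<Longrightarrow> y \<in> R \<Longrightarrow> l < 4 \<Longrightarrow> res l (x + y) = (res l x + res l y) mod 3"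
  using cg_add[OF res_spec[of x l] res_spec[of y l]] by (intro res_unique) (auto simp: algebra_simps)

lemma res_mult:
  assumes "x \<in> R" "y \<in> R" "l < 4"
  shows "res l (x * y) = (res l x * res l y) mod 3"
proof (rule res_unique[OF assms(3)])
  have "cg 3 (E l * x * y) (of_int (res l x) * E l * y)"
    by (intro cg_mult_right res_spec assms)
  also have "of_int (res l x) * E l * y = of_int (res l x) * (E l * y)"
    by simp
  also have "cg 3 \<dots> (of_int (res l x) * (of_int (res l y) * E l))"
    by (intro cg_mult_left res_spec assms of_int_closed)
  finally show "cg 3 (E l * (x * y)) (of_int (res l x * res l y) * E l)"
    by (simp add: mult.assoc)
qed

lemma res_of_int: "l < 4 \<Longrightarrow> res l (of_int k) = k mod 3"
  by (intro res_unique) (auto simp: mult.commute)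

lemma res_E: "i < 4 \<Longrightarrow> l < 4 \<Longrightarrow> res l (E i) = (if i = l then 1 else 0)"
  using res_unique[of l "E i" "if i = l then 1 else 0"] cg_9_3[OF E_mult_cg[of l i]]
  by (auto split: if_splits)

lemma res_multiple: "x \<in> R \<Longrightarrow> l < 4 \<Longrightarrow> res l (3 * x) = 0"
  using res_mult[of 3 x l] res_of_int[of l 3] by (simp add: closed)

lemma poly_closed: "\<theta> \<in> R \<Longrightarrow> poly (map_poly of_int p) \<theta> \<in> R"
  by (induction p) (auto simp: map_poly_pCons intro!: closed)

lemma res_poly:
  assumes "\<theta> \<in> R" "l < 4"
  shows "res l (poly (map_poly of_int p) \<theta>) = poly p (res l \<theta>) mod 3"
proof (induction p)
  case (pCons a p)
  then show ?case
    using assms by (simp add: map_poly_pCons res_add res_mult res_of_int closed poly_closed mod_simps)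
qed (use assms res_of_int[of l 0] in simp)

section \<open>Subgroups of index 3 that contain Z[\<theta>]\<close>

definition eq_res :: "nat \<Rightarrow> nat \<Rightarrow> complex set" where
  "eq_res i j = {x \<in> R. res i x = res j x}"

lemma eq_res_subset: "eq_res i j \<subseteq> R"
  by (auto simp: eq_res_def)

lemma add_subgroup_R: "add_subgroup R"
  by (auto simp: add_subgroup_def closed)

lemma add_subgroup_eq_res: "i < 4 \<Longrightarrow> j < 4 \<Longrightarrow> add_subgroup (eq_res i j)"
  using res_of_int[of i 0] res_of_int[of j 0]
  by (auto simp: add_subgroup_def eq_res_def closed res_diff)

lemma Zring_subset_eq_res:
  assumes "\<theta> \<in> R" "i < 4" "j < 4" "res i \<theta> = res j \<theta>"
  shows "Zring \<theta> \<subseteq> eq_res i j"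
  using assms by (auto simp: Zring_def eq_res_def poly_closed res_poly)

text \<open>The subgroup is the kernel of \<open>res i - res j\<close> modulo 3. This difference is
  1 at \<open>E i\<close>, so 0, \<open>E i\<close> and \<open>E i + E i\<close> represent its three
  cosets.\<close>

lemma card_cosets_eq_res:
  assumes "\<theta> \<in> R" "i < 4" "j < 4" "i \<noteq> j" "res i \<theta> = res j \<theta>"
  shows "card (add_cosets R (Zring \<theta>)) = 3 * card (add_cosets (eq_res i j) (Zring \<theta>))"
proof (rule card_add_cosets_index_3)
  show "E i \<in> R" using assms by (simp add: closed)
  have "res i (E i + E i) = 2" "res j (E i + E i) = 0"
    using assms by (simp_all only: res_add E_closed res_E) auto
  then have two: "res i (2 * E i) = 2" "res j (2 * E i) = 0" and "E i + E i \<notin> eq_res i j"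
    by (simp_all add: eq_res_def mult_2[symmetric])
  then show "E i \<notin> eq_res i j" "E i + E i \<notin> eq_res i j"
    using assms by (auto simp: eq_res_def res_E)
  fix x assume x: "x \<in> R"
  have "(res i x - res j x) mod 3 \<in> {0, 1, 2}"
    using res_range[of i x] res_range[of j x] by auto
  then show "x \<in> eq_res i j \<or> x - E i \<in> eq_res i j \<or> x - (E i + E i) \<in> eq_res i j"
    using x assms res_range[of i x] res_range[of j x]
    by (auto simp: eq_res_def res_diff two res_E closed)
qed (use assms in \<open>simp_all add: add_subgroup_R add_subgroup_eq_res add_subgroup_Zring
      Zring_subset_eq_res eq_res_subset\<close>)

text \<open>There are four residue maps to a field with three elements, so two of them agree at \<open>\<theta>\<close>.\<close>
lemma three_dvd_card_cosets:
  assumes "\<theta> \<in> R"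
  shows "3 dvd card (add_cosets R (Zring \<theta>))"
proof -
  have "(\<lambda>l. res l \<theta>) ` {..<4 :: nat} \<subseteq> {0, 1, 2}"
    using res_range by blast
  then have "card ((\<lambda>l. res l \<theta>) ` {..<4 :: nat}) \<le> card {0, 1, 2 :: int}"
    by (intro card_mono) auto
  then have "card ((\<lambda>l. res l \<theta>) ` {..<4 :: nat}) < card {..<4 :: nat}"
    by simp
  then have "\<not> inj_on (\<lambda>l. res l \<theta>) {..<4 :: nat}"
    by (rule pigeonhole)
  then obtain i j where "i < 4" "j < 4" "i \<noteq> j" "res i \<theta> = res j \<theta>"
    by (auto simp: inj_on_def)
  then show ?thesis
    using card_cosets_eq_res[OF assms] by simp
qed

text \<open>Its coordinates in the \<open>E i\<close> are (0, 1, -1, 3). Modulo 3 only the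
  coordinates 0 and 3 coincide, the least collision possible, and modulo 9 they differ.\<close>

definition gen :: complex where
  "gen = E 1 - E 2 + 3 * E 3"

lemma gen_closed: "gen \<in> R"
  by (simp add: gen_def closed)

declare One_nat_def [simp del]

text \<open>Powers are formed coordinatewise on (0, 1, -1, 3); the last coordinate becomes 9 and 27,
  which vanish modulo 9.\<close>

lemma gen_powers:
  shows "cg 9 (gen ^ 2) (E 1 + E 2)" and "cg 9 (gen ^ 3) (E 1 - E 2)"
proof -
  obtain w11 where w11: "w11 \<in> R" "E 1 * E 1 = E 1 + 9 * w11" using E_mult[of 1 1] by auto
  obtain w22 where w22: "w22 \<in> R" "E 2 * E 2 = E 2 + 9 * w22" using E_mult[of 2 2] by auto
  obtain w12 where w12: "w12 \<in> R" "E 1 * E 2 = 9 * w12" using E_mult[of 1 2] by auto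
  obtain w13 where w13: "w13 \<in> R" "E 1 * E 3 = 9 * w13" using E_mult[of 1 3] by auto
  obtain w23 where w23: "w23 \<in> R" "E 2 * E 3 = 9 * w23" using E_mult[of 2 3] by auto
  have E3: "E 3 \<in> R" by (simp add: closed)
  have "gen ^ 2 = E 1 * E 1 + E 2 * E 2 - 2 * (E 1 * E 2) + 6 * (E 1 * E 3) - 6 * (E 2 * E 3) + 9 * (E 3 * E 3)"
    by (simp add: gen_def power2_eq_square algebra_simps)
  also have "\<dots> = (E 1 + E 2) + 9 * (w11 + w22 - 2 * w12 + 6 * w13 - 6 * w23 + E 3 * E 3)"
    unfolding w11(2) w22(2) w12(2) w13(2) w23(2) by (simp add: algebra_simps)
  finally show *: "cg 9 (gen ^ 2) (E 1 + E 2)"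
    by (rule cgI[where m = 9, unfolded of_int_numeral]) (use w11 w22 w12 w13 w23 E3 in \<open>auto intro!: closed\<close>)
  have "cg 9 (gen * gen ^ 2) (gen * (E 1 + E 2))"
    by (intro cg_mult_left * gen_closed)
  also have "gen * (E 1 + E 2) = E 1 * E 1 - E 2 * E 2 + 3 * (E 1 * E 3) + 3 * (E 2 * E 3)"
    by (simp add: gen_def algebra_simps)
  also have "\<dots> = E 1 - E 2 + 9 * (w11 - w22 + 3 * w13 + 3 * w23)"
    unfolding w11(2) w22(2) w12(2) w13(2) w23(2) by (simp add: algebra_simps)
  also have "cg 9 \<dots> (E 1 - E 2)"
    by (rule cgI[where m = 9, unfolded of_int_numeral, OF refl]) (use w11 w22 w12 w13 w23 E3 in \<open>auto intro!: closed\<close>)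
  finally show "cg 9 (gen ^ 3) (E 1 - E 2)"
    by (simp add: power3_eq_cube power2_eq_square mult.assoc)
qed

lemma gen_powers_independent:
  assumes "(\<Sum>i<4. of_int (c i) * gen ^ i) = 0" and "i < 4"
  shows "c i = 0"
proof (rule int_relation_descent[OF _ assms], intro allI impI)
  fix c :: "nat \<Rightarrow> int" and i :: nat
  assume rel: "(\<Sum>i<4. of_int (c i) * gen ^ i) = 0" and i: "i < 4"
  let ?s = "of_int (c 0) * (E 0 + E 1 + E 2 + E 3) + of_int (c 1) * gen
    + of_int (c 2) * (E 1 + E 2) + of_int (c 3) * (E 1 - E 2)"
  have sE: "cg 9 (E 0 + E 1 + E 2 + E 3) 1"
    using E_sum by (auto simp: cg_def sum_lessThan_4)
  have "cg 9 (of_int (c 0) * (E 0 + E 1 + E 2 + E 3)) (of_int (c 0) * 1)"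
    by (intro cg_mult_left sE of_int_closed)
  moreover have "cg 9 (of_int (c 2) * (E 1 + E 2)) (of_int (c 2) * gen ^ 2)"
    "cg 9 (of_int (c 3) * (E 1 - E 2)) (of_int (c 3) * gen ^ 3)"
    by (intro cg_mult_left cg_sym[OF gen_powers(1)] cg_sym[OF gen_powers(2)] of_int_closed)+
  ultimately have "cg 9 ?s (of_int (c 0) * 1 + of_int (c 1) * gen + of_int (c 2) * gen ^ 2 + of_int (c 3) * gen ^ 3)"
    by (intro cg_add cg_refl)
  also have "\<dots> = 0"
    using rel by (simp add: sum_lessThan_4)
  finally have "cg 9 ?s 0" .
  \<comment> \<open>The coordinates of \<open>?s\<close> in the \<open>E i\<close>. The entries at 0
    and 3 force only \<open>3 dvd c 1\<close>; modulo 3 they would be the same condition and say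
    nothing about \<open>c 1\<close>.\<close>
  moreover define k where "k = (\<lambda>i :: nat. if i = 0 then c 0 else if i = 1 then c 0 + c 1 + c 2 + c 3
    else if i = 2 then c 0 - c 1 + c 2 - c 3 else c 0 + 3 * c 1)"
  have "?s = (\<Sum>i<4. of_int (k i) * E i)"
    by (simp add: k_def gen_def sum_lessThan_4 algebra_simps)
  ultimately have "9 dvd k l" if "l < 4" for l
    using comb_cg_0(2)[OF that] by simp
  from this[of 0] this[of 1] this[of 2] this[of 3]
  have "9 dvd c 0" "9 dvd c 0 + c 1 + c 2 + c 3" "9 dvd c 0 - c 1 + c 2 - c 3" "9 dvd c 0 + 3 * c 1"
    by (simp_all add: k_def)
  then have "3 dvd c 0 \<and> 3 dvd c 1 \<and> 3 dvd c 2 \<and> 3 dvd c 3"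
    by presburger
  moreover have "i \<in> {0, 1, 2, 3}" using i by auto
  ultimately show "3 dvd c i" by auto
qed

lemma multiplicity_3_card_cosets_gen:
  assumes fin: "finite (add_cosets R (Zring gen))"
  shows "multiplicity 3 (card (add_cosets R (Zring gen))) = 1"
proof -
  let ?H = "eq_res 0 3" and ?C = "Zring gen"
  have res: "res 0 gen = res 3 gen"
    by (simp add: gen_def res_add res_diff res_multiple res_E closed)
  have sub: "?C \<subseteq> ?H"
    by (rule Zring_subset_eq_res) (simp_all add: gen_closed res)
  have finH: "finite (add_cosets ?H ?C)"
    by (rule finite_subset[OF _ fin]) (auto simp: add_cosets_def eq_res_def)
  have "\<not> 3 dvd card (add_cosets ?H ?C)"
  proof (rule not_3_dvd_card_add_cosets)
    fix x assume "x \<in> ?H"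
    then have x: "x \<in> R" "res 0 x = res 3 x" by (auto simp: eq_res_def)
    obtain c where c: "cg 3 x (\<Sum>i<4. of_int (c i) * E i)" using coords_mod_3[OF x(1)] by blast
    have c03: "c 0 mod 3 = c 3 mod 3"
      using res_comb[OF _ c, of 0] res_comb[OF _ c, of 3] x by simp
    then obtain e where e: "c 3 = c 0 + 3 * e" 
      by (metis mod_eqE mult.commute)
    obtain z where z: "z \<in> R" "x = (\<Sum>i<4. of_int (c i) * E i) + 3 * z"
      using c by (auto simp: cg_def)
    \<comment> \<open>The excess \<open>3 * e\<close> of \<open>c 3\<close> over \<open>c 0\<close>
      moves into the multiple of 3, so that \<open>x\<close> has equal leading coordinates at 0 and
      3.\<close>
    have ze: "z + of_int e * E 3 \<in> R" using z by (simp add: closed)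
    obtain d where d: "cg 3 (z + of_int e * E 3) (\<Sum>i<4. of_int (d i) * E i)"
      using coords_mod_3[OF ze] by blast
    then obtain w where w: "w \<in> R" "z + of_int e * E 3 = (\<Sum>i<4. of_int (d i) * E i) + 3 * w"
      by (auto simp: cg_def)
    obtain w0 where w0: "w0 \<in> R" "E 0 + E 1 + E 2 + E 3 = 1 + 9 * w0"
      using E_sum by (auto simp: sum_lessThan_4)
    obtain w1 where w1: "w1 \<in> R" "gen ^ 2 = E 1 + E 2 + 9 * w1"
      using gen_powers(1) by (auto simp: cg_def)
    obtain w2 where w2: "w2 \<in> R" "gen ^ 3 = E 1 - E 2 + 9 * w2"
      using gen_powers(2) by (auto simp: cg_def)
    \<comment> \<open>With \<open>x - p = 3 * y\<close>, the coordinates of \<open>y\<close> at 0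
      and 3 are \<open>d 0\<close> and \<open>d 3 - a\<close>, and their equality fixes
      \<open>a\<close>. The values \<open>b\<close> and \<open>g\<close> solve the congruences
      modulo 3 at \<open>E 1\<close> and \<open>E 2\<close>, with -1 in the role of 1/2.\<close>
    define a b g where "a = d 3 - d 0" and "b = 2 * c 0 - c 1 - c 2" and "g = c 2 - c 1 - a"
    define p where "p = of_int (c 0) + of_int a * gen + of_int b * gen ^ 2 + of_int g * gen ^ 3"
    define s where "s = w + of_int (c 0) * w0 - of_int b * w1 - of_int g * w2"
    \<comment> \<open>The common coefficient \<open>d 0\<close> at \<open>E 0\<close> and
      \<open>E 3\<close> is what puts \<open>y\<close> into \<open>?H\<close>; \<open>s\<close>
      collects the remainders modulo 9.\<close>
    define y where "y = of_int (c 1 - c 0 + d 1) * E 1 + of_int (c 2 - c 0 + d 2) * E 2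
      + of_int (d 0) * (E 0 + E 3) + 3 * s"
    have s: "s \<in> R" using w w0 w1 w2 by (auto simp: s_def intro!: closed)
    have x_eq: "x = of_int (c 0) * (E 0 + E 1 + E 2 + E 3) + of_int (c 1 - c 0) * E 1 + of_int (c 2 - c 0) * E 2
       + 3 * (z + of_int e * E 3)"
      by (simp add: z(2) sum_lessThan_4 e algebra_simps)
    have "x - p = y + y + y"
      unfolding x_eq w0(2) w(2) p_def w1(2) w2(2) y_def s_def
      by (simp add: gen_def a_def b_def g_def sum_lessThan_4 algebra_simps)
    then have "x - (y + y + y) = p" by (simp add: algebra_simps)
    moreover have "p = poly (map_poly of_int [:c 0, a, b, g:]) gen"
      by (simp add: p_def of_int_hom.map_poly_pCons_hom power2_eq_square power3_eq_cube algebra_simps)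
    then have "p \<in> ?C" unfolding Zring_def by blast
    moreover have "y \<in> ?H"
      using s res_of_int[of 0 3] res_of_int[of 3 3]
      by (simp add: eq_res_def y_def closed res_add res_mult res_of_int res_E res_multiple)
    ultimately show "\<exists>y\<in>?H. x - (y + y + y) \<in> ?C" by auto
  qed (simp_all add: add_subgroup_eq_res add_subgroup_Zring sub finH)
  moreover have "card (add_cosets R ?C) = 3 * card (add_cosets ?H ?C)"
    by (rule card_cosets_eq_res) (simp_all add: gen_closed res)
  ultimately show ?thesis
    using multiplicity_times_same[of "card (add_cosets ?H ?C)" 3]
    by (cases "card (add_cosets ?H ?C) = 0") (auto simp: not_dvd_imp_multiplicity_0 One_nat_def)
qed

end

section \<open>Quartic number fields\<close>

interpretation of_rat_poly_hom: map_poly_comm_ring_hom "of_rat :: rat \<Rightarrow> complex" ..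

abbreviation rp :: "rat poly \<Rightarrow> complex \<Rightarrow> complex" where
  "rp p \<equiv> poly (map_poly of_rat p)"

abbreviation ip :: "int poly \<Rightarrow> complex \<Rightarrow> complex" where
  "ip p \<equiv> poly (map_poly of_int p)"

lemmas rp_simps = of_rat_poly_hom.hom_add of_rat_poly_hom.hom_mult of_rat_poly_hom.hom_minus
  of_rat_hom.map_poly_pCons_hom of_rat_hom.map_poly_hom_smult of_rat_poly_hom.hom_uminus

lemmas ip_simps = of_int_poly_hom.hom_add of_int_poly_hom.hom_mult of_int_poly_hom.hom_minus
  of_int_hom.map_poly_pCons_hom of_int_hom.map_poly_hom_smult of_int_poly_hom.hom_sum

lemma field_gen_iff: "x \<in> field_gen \<alpha> \<longleftrightarrow> (\<exists>p. x = rp p \<alpha>)"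
  by (auto simp: field_gen_def)

lemma field_gen_closed:
  shows "of_rat q \<in> field_gen \<alpha>" and "\<alpha> \<in> field_gen \<alpha>"
    and "x \<in> field_gen \<alpha> \<Longrightarrow> y \<in> field_gen \<alpha> \<Longrightarrow> x + y \<in> field_gen \<alpha>"
    and "x \<in> field_gen \<alpha> \<Longrightarrow> y \<in> field_gen \<alpha> \<Longrightarrow> x - y \<in> field_gen \<alpha>"
    and "x \<in> field_gen \<alpha> \<Longrightarrow> y \<in> field_gen \<alpha> \<Longrightarrow> x * y \<in> field_gen \<alpha>"
proof -
  have "of_rat q = rp [:q:] \<alpha>" "\<alpha> = rp [:0, 1:] \<alpha>"
    by (simp_all add: rp_simps)
  then show "of_rat q \<in> field_gen \<alpha>" "\<alpha> \<in> field_gen \<alpha>"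
    unfolding field_gen_iff by blast+
  assume "x \<in> field_gen \<alpha>" "y \<in> field_gen \<alpha>"
  then obtain p r where "x = rp p \<alpha>" "y = rp r \<alpha>"
    by (auto simp: field_gen_iff)
  then have "x + y = rp (p + r) \<alpha>" "x - y = rp (p - r) \<alpha>" "x * y = rp (p * r) \<alpha>"
    by (simp_all add: rp_simps)
  then show "x + y \<in> field_gen \<alpha>" "x - y \<in> field_gen \<alpha>" "x * y \<in> field_gen \<alpha>"
    unfolding field_gen_iff by blast+
qed

lemma field_gen_of_int: "of_int k \<in> field_gen \<alpha>"
  using field_gen_closed(1)[of "of_int k"] by simp

lemma field_gen_sum: "(\<And>i. i \<in> A \<Longrightarrow> f i \<in> field_gen \<alpha>) \<Longrightarrow> sum f A \<in> field_gen \<alpha>"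
  using field_gen_closed(1)[of 0 \<alpha>]
  by (induction A rule: infinite_finite_induct) (auto intro: field_gen_closed)

lemma field_gen_power: "x \<in> field_gen \<alpha> \<Longrightarrow> x ^ n \<in> field_gen \<alpha>"
  using field_gen_closed(1)[of 1 \<alpha>]
  by (induction n) (auto intro: field_gen_closed)

lemma field_gen_rp: "\<theta> \<in> field_gen \<alpha> \<Longrightarrow> rp p \<theta> \<in> field_gen \<alpha>"
  using field_gen_closed(1)[of 0 \<alpha>]
  by (induction p) (auto simp: rp_simps intro!: field_gen_closed)

lemma field_gen_ip: "\<theta> \<in> field_gen \<alpha> \<Longrightarrow> ip p \<theta> \<in> field_gen \<alpha>"
  using field_gen_of_int[of 0 \<alpha>]
  by (induction p) (auto simp: ip_simps intro!: field_gen_closed field_gen_of_int)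

lemma field_gen_mono: "\<theta> \<in> field_gen \<alpha> \<Longrightarrow> field_gen \<theta> \<subseteq> field_gen \<alpha>"
  by (auto simp: field_gen_iff[of _ \<theta>] field_gen_rp)

lemma field_gen_divide_int:
  assumes "d \<noteq> 0" and "of_int d * x \<in> field_gen \<alpha>"
  shows "x \<in> field_gen \<alpha>"
proof -
  have "of_rat (1 / of_int d) * (of_int d * x) \<in> field_gen \<alpha>"
    by (intro field_gen_closed assms)
  also have "of_rat (1 / of_int d) * (of_int d * x) = x"
    using assms(1) by (simp add: of_rat_divide)
  finally show ?thesis .
qed

lemma algebraic_int_ip: "algebraic_int x \<Longrightarrow> algebraic_int (ip p x)"
proof (induction p)
  case (pCons k p)
  have "algebraic_int (of_int k + x * ip p x)"
    by (intro algebraic_int_add algebraic_int_mult pCons) (auto intro: int_imp_algebraic_int)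
  then show ?case by (simp add: ip_simps)
qed simp

lemma clear_denominators:
  fixes p :: "rat poly"
  obtains d :: int and q :: "int poly" where "d \<noteq> 0" and "\<And>x. of_int d * rp p x = ip q x"
proof -
  have "\<exists>d q. d \<noteq> 0 \<and> (\<forall>x. of_int d * rp p x = ip q x)"
  proof (induction p)
    case 0
    show ?case by (intro exI[of _ 1] exI[of _ 0]) auto
  next
    case (pCons r p)
    then obtain d q where d: "d \<noteq> 0" "\<And>x. of_int d * rp p x = ip q x" by blast
    obtain m n where mn: "r = of_int m / of_int n" "n \<noteq> 0"
      by (metis Fract_of_int_quotient Rat_cases less_irrefl)
    have "of_int (d * n) * rp (pCons r p) x = ip (pCons (d * m) (Polynomial.smult n q)) x" for x
      using mn(2) by (simp add: rp_simps ip_simps mn(1) of_rat_divide distrib_left flip: d(2))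
    then show ?case
      using d(1) mn(2) by (intro exI[of _ "d * n"]) auto
  qed
  then show ?thesis using that by blast
qed

lemma common_denominator:
  fixes u :: "nat \<Rightarrow> rat"
  obtains d :: int and k :: "nat \<Rightarrow> int" where "d \<noteq> 0" and "\<And>i. i < n \<Longrightarrow> of_int d * u i = of_int (k i)"
proof -
  have "\<exists>d k. d \<noteq> 0 \<and> (\<forall>i<n. of_int d * u i = of_int (k i))"
  proof (induction n)
    case 0
    show ?case by (intro exI[of _ 1]) auto
  next
    case (Suc n)
    then obtain d k where d: "d \<noteq> 0" "\<forall>i<n. of_int d * u i = of_int (k i)" by blast
    obtain m l where ml: "u n = of_int m / of_int l" "l \<noteq> 0"
      by (metis Fract_of_int_quotient Rat_cases less_irrefl)
    define k' where "k' i = (if i = n then d * m else l * k i)" for i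
    have "of_int (d * l) * u i = of_int (k' i)" if "i < Suc n" for i
    proof (cases "i = n")
      case False
      then have "of_int d * u i = of_int (k i)" using d(2) that by auto
      then show ?thesis using False by (simp add: k'_def)
    qed (use ml in \<open>simp add: k'_def\<close>)
    then show ?case
      using d(1) ml(2) by (intro exI[of _ "d * l"] exI[of _ k']) auto
  qed
  then show ?thesis using that by blast
qed

section \<open>Linear independence over the rationals\<close>

interpretation rat_vs: vector_space "\<lambda>q x. of_rat q * x :: complex"
  by unfold_locales (auto simp: algebra_simps of_rat_add of_rat_mult)

text \<open>Rational independence with denominators cleared. It concerns an indexed family rather
  than a set, so that a repeated member counts as a dependence.\<close>

definition int_independent :: "(nat \<Rightarrow> complex) \<Rightarrow> bool" where
  "int_independent e \<longleftrightarrow> (\<forall>c :: nat \<Rightarrow> int. (\<Sum>i<4. of_int (c i) * e i) = 0 \<longrightarrow> (\<forall>i<4. c i = 0))"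

lemma int_independentD:
  "int_independent e \<Longrightarrow> (\<Sum>i<4. of_int (c i) * e i) = 0 \<Longrightarrow> i < 4 \<Longrightarrow> c i = 0"
  unfolding int_independent_def by blast

lemma int_independent_rat:
  assumes e: "int_independent e" and 0: "(\<Sum>i<4. of_rat (u i) * e i) = 0" and i: "i < 4"
  shows "u i = 0"
proof -
  obtain d k where d: "d \<noteq> 0" "\<And>i. i < 4 \<Longrightarrow> of_int d * u i = of_int (k i)"
    using common_denominator[where n = 4 and u = u] by blast
  have "(\<Sum>i<4. of_int (k i) * e i) = of_int d * (\<Sum>i<4. of_rat (u i) * e i)"
    unfolding sum_distrib_left
  proof (rule sum.cong)
    fix i :: nat assume "i \<in> {..<4}"
    then have "(of_rat (of_int d * u i) :: complex) = of_rat (of_int (k i))" using d(2) by simp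
    then show "of_int (k i) * e i = of_int d * (of_rat (u i) * e i)"
      by (simp add: of_rat_mult)
  qed auto
  then have "k i = 0" using int_independentD[OF e _ i] 0 by simp
  then show ?thesis using d(1) d(2)[OF i] by simp
qed

lemma int_independent_inj: "int_independent e \<Longrightarrow> inj_on e {..<4}"
proof (rule inj_onI, rule ccontr)
  fix i j :: nat
  assume e: "int_independent e" and ij: "i \<in> {..<4}" "j \<in> {..<4}" "e i = e j" "i \<noteq> j"
  define c where "c = (\<lambda>k. if k = i then 1 else if k = j then - 1 else 0 :: int)"
  have "(\<Sum>k<4. of_int (c k) * e k) = (\<Sum>k<4. (if k = i then e i else 0) + (if k = j then - e j else 0))"
    by (rule sum.cong) (use ij in \<open>auto simp: c_def\<close>)
  also have "\<dots> = 0"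
    using ij by (simp add: sum.distrib)
  finally show False
    using int_independentD[OF e, of c i] ij by (simp add: c_def)
qed

locale quartic_root =
  fixes a b c :: int and \<alpha> :: complex
  assumes irr: "irreducible (map_poly (of_int :: int \<Rightarrow> rat) [:c, b, 0, a, 1:])"
    and root: "poly (map_poly of_int [:c, b, 0, a, 1:]) \<alpha> = 0"
begin

definition F :: "int poly" where "F = [:c, b, 0, a, 1:]"

lemma ip_F: "ip F x = x ^ 4 + of_int a * x ^ 3 + of_int b * x + of_int c"
  by (simp add: F_def ip_simps eval_nat_numeral algebra_simps)

lemma alpha_root: "ip F \<alpha> = 0"
  using root by (simp add: F_def)

lemma rp_F: "rp (map_poly of_int F) x = ip F x"
  by (simp add: F_def rp_simps ip_simps)

text \<open>An irreducible \<open>F\<close> that does not divide \<open>p\<close> is coprime to it,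
  and a Bezout identity evaluated at \<alpha> would read 0 = 1.\<close>

lemma F_dvd_rat:
  assumes "rp p \<alpha> = 0"
  shows "map_poly of_int F dvd p"
proof (rule ccontr)
  assume nd: "\<not> map_poly of_int F dvd p"
  have "prime_elem (map_poly (of_int :: int \<Rightarrow> rat) F)"
    using irr by (simp add: F_def field_poly_irreducible_imp_prime)
  then have "coprime (map_poly of_int F) p"
    using nd by (rule prime_elem_imp_coprime)
  then obtain u v where "u * map_poly of_int F + v * p = 1"
    by (metis bezout_coefficients_fst_snd coprime_imp_gcd_eq_1)
  then have "rp (u * map_poly of_int F + v * p) \<alpha> = rp 1 \<alpha>"
    by simp
  then show False
    by (simp add: rp_simps rp_F alpha_root assms)
qed

text \<open>This carries the integral equation of an element of the field to its conjugates.\<close>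

lemma rp_conjugate:
  assumes "rp p \<alpha> = 0" and "ip F \<beta> = 0"
  shows "rp p \<beta> = 0"
proof -
  obtain q where "p = map_poly of_int F * q"
    using F_dvd_rat[OF assms(1)] by blast
  then show ?thesis by (simp add: rp_simps rp_F assms(2))
qed

lemma ip_eq_0_imp:
  assumes "ip p \<alpha> = 0" and "degree p < 4"
  shows "p = 0"
proof (rule ccontr)
  assume "p \<noteq> 0"
  have "rp (map_poly of_int p) x = ip p x" for x
    by (induction p) (auto simp: rp_simps ip_simps)
  then have "map_poly of_int F dvd (map_poly of_int p :: rat poly)"
    using assms(1) by (intro F_dvd_rat) simp
  then have "degree (map_poly of_int F :: rat poly) \<le> degree (map_poly of_int p :: rat poly)"
    by (rule dvd_imp_degree_le) (use \<open>p \<noteq> 0\<close> in simp)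
  then have "degree F \<le> degree p" by simp
  then show False using assms(2) by (simp add: F_def)
qed

lemma alpha_powers_independent: "int_independent (\<lambda>i. \<alpha> ^ i)"
  unfolding int_independent_def
proof (intro allI impI)
  fix w :: "nat \<Rightarrow> int" and i :: nat
  assume 0: "(\<Sum>i<4. of_int (w i) * \<alpha> ^ i) = 0" and i: "i < 4"
  have "ip [:w 0, w 1, w 2, w 3:] \<alpha> = 0"
    using 0 by (simp add: sum_lessThan_4 ip_simps power2_eq_square power3_eq_cube algebra_simps)
  then have "[:w 0, w 1, w 2, w 3:] = 0"
    by (rule ip_eq_0_imp) (simp add: degree_pCons_eq_if)
  then have "w 0 = 0" "w 1 = 0" "w 2 = 0" "w 3 = 0" by simp_all
  moreover have "i \<in> {0, 1, 2, 3}" using i by auto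
  ultimately show "w i = 0" by auto
qed

text \<open>\<open>F\<close> is monic, so division leaves an integral remainder. In each Horner step
  the new term \<open>t3 * x ^ 4\<close> is removed by subtracting \<open>t3 * F\<close>.\<close>

lemma reduce_mod_F:
  obtains s :: "int poly" and t :: "nat \<Rightarrow> int" where "g = F * s + [:t 0, t 1, t 2, t 3:]"
proof -
  have "\<exists>s t0 t1 t2 t3. g = F * s + [:t0, t1, t2, t3:]"
  proof (induction g)
    case 0
    show ?case by (intro exI[of _ 0]) simp
  next
    case (pCons k g)
    then obtain s t0 t1 t2 t3 where g: "g = F * s + [:t0, t1, t2, t3:]" by blast
    have "pCons k g = F * (pCons t3 s) + [:k - t3 * c, t0 - t3 * b, t1, t2 - t3 * a:]"
      unfolding g by (simp add: F_def algebra_simps)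
    then show ?case by blast
  qed
  then obtain s t0 t1 t2 t3 where "g = F * s + [:t0, t1, t2, t3:]" by blast
  then show ?thesis
    using that[of s "\<lambda>i. if i = 0 then t0 else if i = 1 then t1 else if i = 2 then t2 else t3"] by simp
qed

lemma ip_pCons4: "ip [:t 0, t 1, t 2, t 3:] \<alpha> = (\<Sum>i<4. of_int (t i) * \<alpha> ^ i)"
  by (simp add: sum_lessThan_4 ip_simps power2_eq_square power3_eq_cube algebra_simps)

lemma ip_alpha_coords:
  obtains w :: "nat \<Rightarrow> int" where "ip g \<alpha> = (\<Sum>i<4. of_int (w i) * \<alpha> ^ i)"
proof -
  obtain s and t :: "nat \<Rightarrow> int" where "g = F * s + [:t 0, t 1, t 2, t 3:]"
    using reduce_mod_F by blast
  then have "ip g \<alpha> = ip [:t 0, t 1, t 2, t 3:] \<alpha>"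
    by (simp add: of_int_poly_hom.hom_add of_int_poly_hom.hom_mult alpha_root)
  then show ?thesis using that ip_pCons4 by simp
qed

lemma field_gen_coords:
  assumes "x \<in> field_gen \<alpha>"
  obtains d :: int and w :: "nat \<Rightarrow> int"
  where "d \<noteq> 0" and "of_int d * x = (\<Sum>i<4. of_int (w i) * \<alpha> ^ i)"
proof -
  obtain p where p: "x = rp p \<alpha>" using assms by (auto simp: field_gen_iff)
  obtain d q where "d \<noteq> 0" "\<And>x. of_int d * rp p x = ip q x"
    using clear_denominators[of p] by blast
  moreover obtain w :: "nat \<Rightarrow> int" where "ip q \<alpha> = (\<Sum>i<4. of_int (w i) * \<alpha> ^ i)"
    using ip_alpha_coords by blast
  ultimately show ?thesis using that p by simp
qed

lemma field_gen_subset_span: "field_gen \<alpha> \<subseteq> rat_vs.span ((\<lambda>i. \<alpha> ^ i) ` {..<4})"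
proof
  fix x assume "x \<in> field_gen \<alpha>"
  then obtain d :: int and w :: "nat \<Rightarrow> int"
    where d: "d \<noteq> 0" "of_int d * x = (\<Sum>i<4. of_int (w i) * \<alpha> ^ i)"
    by (rule field_gen_coords)
  have "(\<Sum>i<4. of_rat (of_int (w i) / of_int d) * \<alpha> ^ i) \<in> rat_vs.span ((\<lambda>i. \<alpha> ^ i) ` {..<4})"
    by (intro rat_vs.span_sum rat_vs.span_scale rat_vs.span_base) auto
  also have "(\<Sum>i<4. of_rat (of_int (w i) / of_int d) * \<alpha> ^ i) = (\<Sum>i<4. of_int (w i) * \<alpha> ^ i) / of_int d"
    by (simp add: of_rat_divide sum_divide_distrib)
  also have "\<dots> = x"
    using d by (simp flip: d(2))
  finally show "x \<in> rat_vs.span ((\<lambda>i. \<alpha> ^ i) ` {..<4})" .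
qed

text \<open>An \<open>x\<close> outside the span would give five independent numbers in a space
  spanned by four powers of \<alpha>.\<close>

lemma independent_imp_basis:
  assumes e: "int_independent e" and eK: "\<And>i. i < 4 \<Longrightarrow> e i \<in> field_gen \<alpha>"
    and x: "x \<in> field_gen \<alpha>"
  obtains d :: int and k :: "nat \<Rightarrow> int" where "d \<noteq> 0" and "of_int d * x = (\<Sum>i<4. of_int (k i) * e i)"
proof -
  let ?S = "e ` {..<4}"
  have inj: "inj_on e {..<4}"
    using e by (rule int_independent_inj)
  have ind: "rat_vs.independent ?S"
  proof
    assume "rat_vs.dependent ?S"
    then obtain u where u: "\<exists>v\<in>?S. u v \<noteq> 0" "(\<Sum>v\<in>?S. of_rat (u v) * v) = 0"
      unfolding rat_vs.dependent_finite[OF finite_imageI[OF finite_lessThan]] by blast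
    from u(2) have "(\<Sum>i<4. of_rat (u (e i)) * e i) = 0"
      by (simp add: sum.reindex[OF inj])
    then have "u (e i) = 0" if "i < 4" for i
      using int_independent_rat[OF e, of "\<lambda>i. u (e i)"] that by blast
    then show False using u(1) by auto
  qed
  have "x \<in> rat_vs.span ?S"
  proof (rule ccontr)
    assume nx: "x \<notin> rat_vs.span ?S"
    then have "rat_vs.independent (insert x ?S)"
      using ind by (rule rat_vs.independent_insertI)
    moreover have "insert x ?S \<subseteq> rat_vs.span ((\<lambda>i. \<alpha> ^ i) ` {..<4})"
      using x eK field_gen_subset_span by auto
    ultimately have "card (insert x ?S) \<le> card ((\<lambda>i. \<alpha> ^ i) ` {..<4 :: nat})"
      using rat_vs.independent_span_bound[of "(\<lambda>i. \<alpha> ^ i) ` {..<4}" "insert x ?S"] by blast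
    also have "\<dots> \<le> 4"
      using card_image_le[of "{..<4 :: nat}" "\<lambda>i. \<alpha> ^ i"] by simp
    finally have "card (insert x ?S) \<le> 4" .
    moreover have "x \<notin> ?S" using nx rat_vs.span_base[of x ?S] by argo
    ultimately show False by (simp add: card_image[OF inj])
  qed
  then obtain u where "x = (\<Sum>v\<in>?S. of_rat (u v) * v)"
    unfolding rat_vs.span_finite[OF finite_imageI[OF finite_lessThan]] by blast
  then have xu: "x = (\<Sum>i<4. of_rat (u (e i)) * e i)"
    by (simp add: sum.reindex[OF inj])
  obtain d and k :: "nat \<Rightarrow> int" where d: "d \<noteq> 0" "\<And>i. i < 4 \<Longrightarrow> of_int d * u (e i) = of_int (k i)"
    using common_denominator[where n = 4 and u = "\<lambda>i. u (e i)"] by blast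
  have "of_int d * x = (\<Sum>i<4. of_int (k i) * e i)"
    unfolding xu sum_distrib_left
  proof (rule sum.cong)
    fix i :: nat assume "i \<in> {..<4}"
    then have "(of_rat (of_int d * u (e i)) :: complex) = of_rat (of_int (k i))" using d(2) by simp
    then show "of_int d * (of_rat (u (e i)) * e i) = of_int (k i) * e i"
      by (simp add: of_rat_mult)
  qed auto
  then show ?thesis using that d(1) by blast
qed

end

lemma rp_pcompose_ip: "rp (pcompose (map_poly of_int P) h) x = ip P (rp h x)"
  by (induction P) (simp_all add: pcompose_pCons rp_simps ip_simps)

context quartic_root
begin

lemma algebraic_int_root_F: "ip F x = 0 \<Longrightarrow> algebraic_int x"
  unfolding algebraic_int_altdef_ipoly by (intro exI[of _ F]) (simp add: F_def)

lemma algebraic_int_alpha: "algebraic_int \<alpha>"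
  by (rule algebraic_int_root_F) (rule alpha_root)

section \<open>Conjugates, traces and a bound for denominators\<close>

lemma conjugates:
  obtains \<beta> \<gamma> \<delta> where "\<alpha> + \<beta> + \<gamma> + \<delta> = - of_int a"
    and "\<alpha> * \<beta> + \<alpha> * \<gamma> + \<alpha> * \<delta> + \<beta> * \<gamma> + \<beta> * \<delta> + \<gamma> * \<delta> = 0"
    and "\<alpha> * \<beta> * \<gamma> + \<alpha> * \<beta> * \<delta> + \<alpha> * \<gamma> * \<delta> + \<beta> * \<gamma> * \<delta> = - of_int b"
    and "ip F \<beta> = 0" and "ip F \<gamma> = 0" and "ip F \<delta> = 0"
proof -
  let ?a = "complex_of_int a" and ?b = "complex_of_int b" and ?c = "complex_of_int c"
  \<comment> \<open>The cubic is the quotient of \<open>F\<close> by X - \<alpha>; dividing it by X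
    - \<beta> gives the quadratic for \<gamma>.\<close>
  obtain \<beta> where "poly [:\<alpha> ^ 3 + ?a * \<alpha> ^ 2 + ?b, \<alpha> ^ 2 + ?a * \<alpha>, \<alpha> + ?a, 1:] \<beta> = 0"
    using alg_closed_imp_poly_has_root[of "[:\<alpha> ^ 3 + ?a * \<alpha> ^ 2 + ?b, \<alpha> ^ 2 + ?a * \<alpha>, \<alpha> + ?a, 1:]"]
    by auto
  then have \<beta>: "\<beta> ^ 3 + (\<alpha> + ?a) * \<beta> ^ 2 + (\<alpha> ^ 2 + ?a * \<alpha>) * \<beta> + (\<alpha> ^ 3 + ?a * \<alpha> ^ 2 + ?b) = 0"
    by (simp add: power2_eq_square power3_eq_cube algebra_simps)
  obtain \<gamma> where "poly [:\<beta> ^ 2 + (\<alpha> + ?a) * \<beta> + (\<alpha> ^ 2 + ?a * \<alpha>), \<beta> + \<alpha> + ?a, 1:] \<gamma> = 0"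
    using alg_closed_imp_poly_has_root[of "[:\<beta> ^ 2 + (\<alpha> + ?a) * \<beta> + (\<alpha> ^ 2 + ?a * \<alpha>), \<beta> + \<alpha> + ?a, 1:]"]
    by auto
  then have \<gamma>: "\<gamma> ^ 2 + (\<beta> + \<alpha> + ?a) * \<gamma> + (\<beta> ^ 2 + (\<alpha> + ?a) * \<beta> + (\<alpha> ^ 2 + ?a * \<alpha>)) = 0"
    by (simp add: power2_eq_square algebra_simps)
  define \<delta> where "\<delta> = - ?a - \<alpha> - \<beta> - \<gamma>"
  have \<alpha>: "\<alpha> ^ 4 + ?a * \<alpha> ^ 3 + ?b * \<alpha> + ?c = 0"
    using alpha_root by (simp add: ip_F)
  have e1: "\<alpha> + \<beta> + \<gamma> + \<delta> = - ?a"
    by (simp add: \<delta>_def)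
  have e2: "\<alpha> * \<beta> + \<alpha> * \<gamma> + \<alpha> * \<delta> + \<beta> * \<gamma> + \<beta> * \<delta> + \<gamma> * \<delta> = 0"
    using \<gamma> unfolding \<delta>_def by Groebner_Basis.algebra
  have e3: "\<alpha> * \<beta> * \<gamma> + \<alpha> * \<beta> * \<delta> + \<alpha> * \<gamma> * \<delta> + \<beta> * \<gamma> * \<delta> = - ?b"
    using \<gamma> \<beta> unfolding \<delta>_def by Groebner_Basis.algebra
  have e4: "\<alpha> * \<beta> * \<gamma> * \<delta> = ?c"
    using e1 e2 e3 \<alpha> by Groebner_Basis.algebra
  have "x ^ 4 + ?a * x ^ 3 + ?b * x + ?c = (x - \<alpha>) * (x - \<beta>) * (x - \<gamma>) * (x - \<delta>)" for x
    using e1 e2 e3 e4 by Groebner_Basis.algebra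
  then have "ip F \<beta> = 0" "ip F \<gamma> = 0" "ip F \<delta> = 0"
    unfolding ip_F by simp_all
  then show ?thesis using that e1 e2 e3 by blast
qed

text \<open>If \<open>\<alpha>\<^sub>k\<close> are the conjugates of \<open>\<alpha>\<close> and \<open>x\<^sub>k\<close> those of an integral \<open>x\<close>, then
  \<open>\<Sum>k. x\<^sub>k F(X) / (X - \<alpha>\<^sub>k)\<close> has integer coefficients, and its value at \<open>\<alpha>\<close> is \<open>x F'(\<alpha>)\<close>.\<close>
lemma bounded_denominator:
  obtains D :: int where "D \<noteq> 0"
    and "\<And>x. x \<in> ring_of_integers \<alpha> \<Longrightarrow> \<exists>w :: nat \<Rightarrow> int. of_int D * x = (\<Sum>i<4. of_int (w i) * \<alpha> ^ i)"
proof -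
  let ?a = "complex_of_int a" and ?b = "complex_of_int b" and ?c = "complex_of_int c"
  obtain \<beta> \<gamma> \<delta> where e1: "\<alpha> + \<beta> + \<gamma> + \<delta> = - ?a"
    and e2: "\<alpha> * \<beta> + \<alpha> * \<gamma> + \<alpha> * \<delta> + \<beta> * \<gamma> + \<beta> * \<delta> + \<gamma> * \<delta> = 0"
    and e3: "\<alpha> * \<beta> * \<gamma> + \<alpha> * \<beta> * \<delta> + \<alpha> * \<gamma> * \<delta> + \<beta> * \<gamma> * \<delta> = - ?b"
    and roots: "ip F \<beta> = 0" "ip F \<gamma> = 0" "ip F \<delta> = 0"
    using conjugates by blast
  define dF where "dF = 4 * \<alpha> ^ 3 + 3 * ?a * \<alpha> ^ 2 + ?b"
  have "dF = ip [:b, 0, 3 * a, 4:] \<alpha>"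
    by (simp add: dF_def ip_simps power2_eq_square power3_eq_cube algebra_simps)
  moreover have "ip [:b, 0, 3 * a, 4:] \<alpha> \<noteq> 0"
    using ip_eq_0_imp[of "[:b, 0, 3 * a, 4:]"] by (auto simp: degree_pCons_eq_if)
  ultimately have dF0: "dF \<noteq> 0" by simp
  have dF_prod: "dF = (\<alpha> - \<beta>) * (\<alpha> - \<gamma>) * (\<alpha> - \<delta>)"
    using e1 e2 e3 unfolding dF_def by Groebner_Basis.algebra
  then have neq: "\<beta> \<noteq> \<alpha>" "\<gamma> \<noteq> \<alpha>" "\<delta> \<noteq> \<alpha>"
    using dF0 by auto
  have dFK: "dF \<in> field_gen \<alpha>"
    unfolding \<open>dF = ip _ _\<close> by (intro field_gen_ip field_gen_closed)
  have ind: "int_independent (\<lambda>i. dF * \<alpha> ^ i)"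
    unfolding int_independent_def
  proof (intro allI impI)
    fix w :: "nat \<Rightarrow> int" and i :: nat
    assume "(\<Sum>i<4. of_int (w i) * (dF * \<alpha> ^ i)) = 0" and i: "i < 4"
    then have "dF * (\<Sum>i<4. of_int (w i) * \<alpha> ^ i) = 0"
      by (simp add: sum_distrib_left mult.left_commute)
    then show "w i = 0"
      using dF0 int_independentD[OF alpha_powers_independent _ i] by simp
  qed
  have "1 \<in> field_gen \<alpha>"
    using field_gen_of_int[of 1] by simp
  \<comment> \<open>Expressing a multiple \<open>D\<close> of 1 in the basis
    \<open>dF * \<alpha> ^ i\<close> makes \<open>D\<close> a multiple of \<open>dF\<close> in
    Z[\<alpha>]. Once \<open>x * dF\<close> lies in Z[\<alpha>], so does
    \<open>D * x\<close>.\<close>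
  then obtain D :: int and k :: "nat \<Rightarrow> int"
    where D: "D \<noteq> 0" "of_int D * 1 = (\<Sum>i<4. of_int (k i) * (dF * \<alpha> ^ i))"
    by (rule independent_imp_basis[OF ind, rotated])
       (auto intro!: field_gen_closed field_gen_power dFK)
  have Dk: "of_int D = ip [:k 0, k 1, k 2, k 3:] \<alpha> * dF"
    unfolding ip_pCons4 using D(2) by (simp add: sum_distrib_left mult_ac)
  \<comment> \<open>The value at \<alpha> of the polynomial (F(X) - F(\<rho>)) / (X - \<rho>): it
    vanishes at the other roots and is F'(\<alpha>) for \<rho> = \<alpha>.\<close>
  define Q where "Q \<rho> = \<alpha> ^ 3 + (\<rho> + ?a) * \<alpha> ^ 2 + (\<rho> ^ 2 + ?a * \<rho>) * \<alpha> + (\<rho> ^ 3 + ?a * \<rho> ^ 2 + ?b)" for \<rho>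
  have Q\<alpha>: "Q \<alpha> = dF"
    by (simp add: Q_def dF_def power2_eq_square power3_eq_cube algebra_simps)
  have Q0: "Q \<rho> = 0" if "ip F \<rho> = 0" "\<rho> \<noteq> \<alpha>" for \<rho>
  proof -
    have "(\<alpha> - \<rho>) * Q \<rho> = ip F \<alpha> - ip F \<rho>"
      unfolding ip_F Q_def by Groebner_Basis.algebra
    then show ?thesis using that alpha_root by simp
  qed
  have pw: "\<rho> ^ (n + 4) = - ?a * \<rho> ^ (n + 3) - ?b * \<rho> ^ (n + 1) - ?c * \<rho> ^ n" if "ip F \<rho> = 0" for \<rho> n
  proof -
    have "\<rho> ^ 4 = - ?a * \<rho> ^ 3 - ?b * \<rho> - ?c"
      using that unfolding ip_F by Groebner_Basis.algebra
    then have "\<rho> ^ n * \<rho> ^ 4 = \<rho> ^ n * (- ?a * \<rho> ^ 3 - ?b * \<rho> - ?c)" by simp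
    then show ?thesis by (simp add: power_add algebra_simps)
  qed
  \<comment> \<open>Power sums of the roots: Newton's identities give the first four, and the
    recurrence from \<open>F\<close> the others.\<close>
  define S where "S n = \<alpha> ^ n + \<beta> ^ n + \<gamma> ^ n + \<delta> ^ n" for n
  have S_rat: "S n \<in> \<rat>" for n
  proof (induction n rule: less_induct)
    case (less n)
    show ?case
    proof (cases "n < 4")
      case True
      then have "n \<in> {0, 1, 2, 3}" by auto
      moreover have "S 0 = 4" by (simp add: S_def)
      moreover have "S 1 = - ?a" using e1 by (simp add: S_def)
      moreover have "S 2 = ?a ^ 2" using e1 e2 unfolding S_def by Groebner_Basis.algebra
      moreover have "S 3 = - (?a ^ 3) - 3 * ?b" using e1 e2 e3 unfolding S_def by Groebner_Basis.algebra
      ultimately show ?thesis by auto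
    next
      case False
      then obtain m where m: "n = m + 4" by (metis add.commute le_Suc_ex not_less)
      have "S n = - ?a * S (m + 3) - ?b * S (m + 1) - ?c * S m"
        unfolding S_def m pw[OF alpha_root] pw[OF roots(1)] pw[OF roots(2)] pw[OF roots(3)]
        by (simp add: algebra_simps)
      then show ?thesis
        using less[of "m + 3"] less[of "m + 1"] less[of m] m by auto
    qed
  qed
  have main: "\<exists>w :: nat \<Rightarrow> int. of_int D * x = (\<Sum>i<4. of_int (w i) * \<alpha> ^ i)"
    if x: "x \<in> ring_of_integers \<alpha>" for x
  proof -
    obtain h where h: "x = rp h \<alpha>"
      using x by (auto simp: ring_of_integers_def field_gen_iff)
    obtain P where P: "ip P x = 0" "lead_coeff P = 1"
      using x by (auto simp: ring_of_integers_def algebraic_int_altdef_ipoly)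
    have alg: "algebraic_int (rp h \<rho>)" if "ip F \<rho> = 0" for \<rho>
    proof -
      have "rp (pcompose (map_poly of_int P) h) \<rho> = 0"
        by (rule rp_conjugate[OF _ that]) (use P h in \<open>simp add: rp_pcompose_ip\<close>)
      then show ?thesis
        using P(2) by (auto simp: rp_pcompose_ip algebraic_int_altdef_ipoly)
    qed
    \<comment> \<open>The trace of \<open>x * \<alpha> ^ j\<close>. It is rational as a rational
      combination of power sums, and integral as a sum of algebraic integers, hence an
      integer.\<close>
    define T where "T j = rp h \<alpha> * \<alpha> ^ j + rp h \<beta> * \<beta> ^ j + rp h \<gamma> * \<gamma> ^ j + rp h \<delta> * \<delta> ^ j" for j
    have T_rat: "T j \<in> \<rat>" for j
      unfolding T_def
    proof (induction h arbitrary: j)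
      case (pCons q h)
      have "rp (pCons q h) \<rho> * \<rho> ^ j = of_rat q * \<rho> ^ j + rp h \<rho> * \<rho> ^ Suc j" for \<rho>
        by (simp add: rp_simps algebra_simps)
      then have "rp (pCons q h) \<alpha> * \<alpha> ^ j + rp (pCons q h) \<beta> * \<beta> ^ j + rp (pCons q h) \<gamma> * \<gamma> ^ j
          + rp (pCons q h) \<delta> * \<delta> ^ j = of_rat q * S j
          + (rp h \<alpha> * \<alpha> ^ Suc j + rp h \<beta> * \<beta> ^ Suc j + rp h \<gamma> * \<gamma> ^ Suc j + rp h \<delta> * \<delta> ^ Suc j)"
        by (simp add: S_def algebra_simps)
      also have "\<dots> \<in> \<rat>"
        by (intro Rats_add Rats_mult pCons.IH S_rat Rats_of_rat)
      finally show ?case .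
    qed simp
    have "algebraic_int (T j)" for j
      unfolding T_def
      by (intro algebraic_int_add algebraic_int_mult algebraic_int_power alg roots alpha_root
          algebraic_int_root_F)
    then have "\<exists>z. T j = of_int z" for j
      using rational_algebraic_int_is_int[OF _ T_rat, of j] Ints_cases[of "T j"] by blast
    then obtain t where t: "T j = of_int (t j)" for j
      by metis
    have "x * dF = rp h \<alpha> * Q \<alpha> + rp h \<beta> * Q \<beta> + rp h \<gamma> * Q \<gamma> + rp h \<delta> * Q \<delta>"
      by (simp add: h Q\<alpha> Q0 roots neq)
    also have "\<dots> = T 0 * \<alpha> ^ 3 + (T 1 + ?a * T 0) * \<alpha> ^ 2 + (T 2 + ?a * T 1) * \<alpha> + (T 3 + ?a * T 2 + ?b * T 0)"
      unfolding T_def Q_def by (simp add: algebra_simps)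
    also have "\<dots> = ip [:t 3 + a * t 2 + b * t 0, t 2 + a * t 1, t 1 + a * t 0, t 0:] \<alpha>"
      unfolding t by (simp add: ip_simps power2_eq_square power3_eq_cube algebra_simps)
    finally have "of_int D * x = ip ([:k 0, k 1, k 2, k 3:]
        * [:t 3 + a * t 2 + b * t 0, t 2 + a * t 1, t 1 + a * t 0, t 0:]) \<alpha>"
      by (simp only: Dk mult.assoc mult.commute[of dF] of_int_poly_hom.hom_mult poly_mult)
    then show ?thesis using ip_alpha_coords by metis
  qed
  show ?thesis by (rule that[OF D(1) main])
qed

text \<open>\<open>D\<close> bounds the denominators of the integers over Z[\<alpha>], and
  \<open>m\<close> those of the powers of \<alpha> over Z[\<theta>]. Hence the coordinates of
  \<open>D * x\<close> modulo \<open>D * m\<close> determine the coset of \<open>x\<close>.\<close>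

lemma finite_index:
  assumes \<theta>: "\<theta> \<in> field_gen \<alpha>" and ind: "int_independent (\<lambda>i. \<theta> ^ i)"
  shows "finite (add_cosets (ring_of_integers \<alpha>) (Zring \<theta>))"
proof -
  obtain D :: int where D: "D \<noteq> 0"
    and "\<And>x. x \<in> ring_of_integers \<alpha> \<Longrightarrow> \<exists>w :: nat \<Rightarrow> int. of_int D * x = (\<Sum>i<4. of_int (w i) * \<alpha> ^ i)"
    using bounded_denominator by blast
  then obtain w :: "complex \<Rightarrow> nat \<Rightarrow> int"
    where w: "\<And>x. x \<in> ring_of_integers \<alpha> \<Longrightarrow> of_int D * x = (\<Sum>i<4. of_int (w x i) * \<alpha> ^ i)"
    by metis
  have "\<exists>d k. d \<noteq> 0 \<and> of_int d * \<alpha> ^ j = (\<Sum>i<4. of_int (k i) * \<theta> ^ i)" for j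
    by (rule independent_imp_basis[OF ind, of "\<alpha> ^ j"])
       (auto intro: field_gen_power \<theta> field_gen_closed)
  then obtain d :: "nat \<Rightarrow> int" and k :: "nat \<Rightarrow> nat \<Rightarrow> int"
    where d: "\<And>j. d j \<noteq> 0" "\<And>j. of_int (d j) * \<alpha> ^ j = (\<Sum>i<4. of_int (k j i) * \<theta> ^ i)"
    by metis
  define m where "m = (\<Prod>j<4. d j)"
  have m0: "m \<noteq> 0" by (simp add: m_def d)
  note Z = add_subgroup_Zring[of \<theta>]
  have Z_scale: "of_int n * z \<in> Zring \<theta>" if z: "z \<in> Zring \<theta>" for n :: int and z
  proof -
    obtain p where "z = ip p \<theta>" using z by (auto simp: Zring_def)
    then have "of_int n * z = ip (Polynomial.smult n p) \<theta>" by (simp add: ip_simps)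
    then show ?thesis unfolding Zring_def by blast
  qed
  have Z_sum: "sum f A \<in> Zring \<theta>" if "\<And>i. i \<in> A \<Longrightarrow> f i \<in> Zring \<theta>" for f and A :: "nat set"
    using that add_subgroupD(1,4)[OF Z]
    by (induction A rule: infinite_finite_induct) auto
  have Z_pow: "\<theta> ^ i \<in> Zring \<theta>" for i
    unfolding Zring_def by (intro CollectI exI[of _ "Polynomial.monom 1 i"]) (simp add: poly_monom)
  have m\<alpha>: "of_int m * \<alpha> ^ j \<in> Zring \<theta>" if "j < 4" for j
  proof -
    have "d j dvd m" unfolding m_def using that by (intro dvd_prodI) auto
    then obtain n where n: "m = n * d j" by (metis dvd_def mult.commute)
    have "of_int m * \<alpha> ^ j = of_int n * (\<Sum>i<4. of_int (k j i) * \<theta> ^ i)"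
      by (simp add: n mult.assoc flip: d(2))
    then show ?thesis by (simp add: Z_scale Z_sum Z_pow)
  qed
  define f where "f x = (\<lambda>i. if i < 4 then w x i mod \<bar>D * m\<bar> else 0)" for x
  have "f ` ring_of_integers \<alpha> \<subseteq> {g. \<forall>i. (i \<in> {..<4} \<longrightarrow> g i \<in> {0..<\<bar>D * m\<bar>}) \<and> (i \<notin> {..<4} \<longrightarrow> g i = 0)}"
    using D m0 by (auto simp: f_def)
  moreover have "finite {g :: nat \<Rightarrow> int. \<forall>i. (i \<in> {..<4} \<longrightarrow> g i \<in> {0..<\<bar>D * m\<bar>}) \<and> (i \<notin> {..<4} \<longrightarrow> g i = 0)}"
    by (rule finite_set_of_finite_funs) auto
  ultimately have fin: "finite (f ` ring_of_integers \<alpha>)"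
    by (rule finite_subset)
  have same: "(+) x ` Zring \<theta> = (+) y ` Zring \<theta>"
    if x: "x \<in> ring_of_integers \<alpha>" and y: "y \<in> ring_of_integers \<alpha>" and fxy: "f x = f y" for x y
  proof -
    have "\<exists>q. w x i - w y i = D * m * q" if "i < 4" for i
    proof -
      have "w x i mod \<bar>D * m\<bar> = w y i mod \<bar>D * m\<bar>"
        using fun_cong[OF fxy, of i] that by (simp add: f_def)
      then have "D * m dvd w x i - w y i" by (simp add: mod_eq_dvd_iff)
      then show ?thesis by blast
    qed
    then obtain q where q: "\<And>i. i < 4 \<Longrightarrow> w x i - w y i = D * m * q i" by metis
    have "of_int D * (x - y) = (\<Sum>i<4. of_int (w x i - w y i) * \<alpha> ^ i)"
      using w[OF x] w[OF y] by (simp add: algebra_simps sum_subtractf)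
    also have "\<dots> = (\<Sum>i<4. of_int D * (of_int (q i) * (of_int m * \<alpha> ^ i)))"
      by (rule sum.cong) (auto simp: q mult_ac simp del: of_int_diff)
    also have "\<dots> = of_int D * (\<Sum>i<4. of_int (q i) * (of_int m * \<alpha> ^ i))"
      by (simp add: sum_distrib_left)
    finally have "x - y = (\<Sum>i<4. of_int (q i) * (of_int m * \<alpha> ^ i))"
      using D by simp
    also have "\<dots> \<in> Zring \<theta>"
      by (intro Z_sum Z_scale m\<alpha>) auto
    finally show ?thesis by (simp add: add_coset_eq_iff[OF Z])
  qed
  have "add_cosets (ring_of_integers \<alpha>) (Zring \<theta>)
      \<subseteq> (\<lambda>g. (+) (SOME x. x \<in> ring_of_integers \<alpha> \<and> f x = g) ` Zring \<theta>) ` (f ` ring_of_integers \<alpha>)"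
  proof
    fix X assume "X \<in> add_cosets (ring_of_integers \<alpha>) (Zring \<theta>)"
    then obtain x where x: "x \<in> ring_of_integers \<alpha>" "X = (+) x ` Zring \<theta>"
      by (auto simp: add_cosets_def)
    let ?y = "SOME y. y \<in> ring_of_integers \<alpha> \<and> f y = f x"
    have "?y \<in> ring_of_integers \<alpha> \<and> f ?y = f x"
      by (rule someI[of _ x]) (simp add: x)
    then have "X = (+) ?y ` Zring \<theta>" using same x by metis
    then show "X \<in> (\<lambda>g. (+) (SOME x. x \<in> ring_of_integers \<alpha> \<and> f x = g) ` Zring \<theta>) ` (f ` ring_of_integers \<alpha>)"
      using x(1) by blast
  qed
  then show ?thesis using fin finite_surj by blast
qed

end

section \<open>Lagrange idempotents\<close>

lemma pow_3_dvd_cancel: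
  fixes D t :: int
  assumes dvd: "3 ^ M dvd D * t" and "D \<noteq> 0" and "multiplicity 3 D \<le> n"
  shows "3 ^ (M - n) dvd t"
proof (cases "t = 0")
  case False
  have p3: "prime_elem (3 :: int)" by simp
  have "M \<le> multiplicity 3 (D * t)"
    using dvd False assms(2) by (subst power_dvd_iff_le_multiplicity[symmetric]) auto
  also have "\<dots> = multiplicity 3 D + multiplicity 3 t"
    by (rule prime_elem_multiplicity_mult_distrib[OF p3]) (use False assms(2) in auto)
  finally show ?thesis
    using assms(3) by (intro multiplicity_dvd') linarith
qed simp

text \<open>A substitute for division: the part of \<open>d\<close> prime to 3 is inverted modulo
  \<open>3 ^ M\<close>, and its power of 3 is completed to \<open>3 ^ k\<close>.\<close>

lemma pow_3_inverse:
  fixes d :: int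
  assumes "d \<noteq> 0" and "multiplicity 3 d \<le> k"
  obtains u where "3 ^ M dvd u * d - 3 ^ k"
proof -
  obtain w where w: "d = 3 ^ multiplicity 3 d * w" "\<not> 3 dvd w"
    using multiplicity_decompose'[of d "3 :: int"] assms(1) by auto
  have "prime (3 :: int)" by simp
  then have "coprime w (3 ^ M)"
    using w(2) by (metis coprime_commute coprime_power_right_iff prime_imp_coprime)
  then obtain v where "[w * v = 1] (mod 3 ^ M)"
    using cong_solve_coprime_int by blast
  then have "3 ^ M dvd w * v - 1"
    by (simp add: cong_iff_dvd_diff)
  moreover have "3 ^ (k - multiplicity 3 d) * v * d - 3 ^ k = 3 ^ k * (w * v - 1)"
  proof -
    have k: "(3 :: int) ^ k = 3 ^ (k - multiplicity 3 d) * 3 ^ multiplicity 3 d"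
      using assms(2) by (simp flip: power_add)
    have "3 ^ (k - multiplicity 3 d) * v * d = 3 ^ (k - multiplicity 3 d) * v * (3 ^ multiplicity 3 d * w)"
      using w(1) by simp
    also have "\<dots> = 3 ^ k * (w * v)" by (simp add: k mult_ac)
    finally show ?thesis by (simp add: algebra_simps)
  qed
  ultimately show ?thesis using that by (metis dvd_mult)
qed

context quartic_root
begin

lemma ring_of_integers_closed:
  shows "1 \<in> ring_of_integers \<alpha>"
    and "x \<in> ring_of_integers \<alpha> \<Longrightarrow> y \<in> ring_of_integers \<alpha> \<Longrightarrow> x - y \<in> ring_of_integers \<alpha>"
    and "x \<in> ring_of_integers \<alpha> \<Longrightarrow> y \<in> ring_of_integers \<alpha> \<Longrightarrow> x * y \<in> ring_of_integers \<alpha>"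
  using field_gen_of_int[of 1 \<alpha>]
  by (auto simp: ring_of_integers_def intro: field_gen_closed algebraic_int_diff algebraic_int_mult
      int_imp_algebraic_int)

lemma ip_alpha_integer: "ip p \<alpha> \<in> ring_of_integers \<alpha>"
  by (simp add: ring_of_integers_def field_gen_ip field_gen_closed algebraic_int_ip algebraic_int_alpha)

lemma pow_3_ip_alpha_integer: "3 ^ n * ip p \<alpha> \<in> ring_of_integers \<alpha>"
  using ip_alpha_integer[of "Polynomial.smult (3 ^ n) p"] by (simp add: ip_simps)

end

text \<open>The \<open>r i\<close> stand for the 3-adic roots of \<open>F\<close>, known to
  precision \<open>M\<close>; \<open>B\<close> bounds the valuations of their differences.\<close>

locale quartic_approx = quartic_root +
  fixes r :: "nat \<Rightarrow> int" and B M :: nat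
  assumes r_root: "i < 4 \<Longrightarrow> 3 ^ M dvd poly F (r i)"
    and r_sep: "i < 4 \<Longrightarrow> j < 4 \<Longrightarrow> i \<noteq> j \<Longrightarrow> \<not> 3 ^ Suc B dvd r i - r j"
begin

definition L :: "nat \<Rightarrow> int poly" where
  "L i = (\<Prod>j\<in>{..<4} - {i}. [:- r j, 1:])"

definition \<Delta> :: "nat \<Rightarrow> int" where
  "\<Delta> i = poly (L i) (r i)"

lemma r_neq: "i < 4 \<Longrightarrow> j < 4 \<Longrightarrow> i \<noteq> j \<Longrightarrow> r i \<noteq> r j"
  using r_sep[of i j] by auto

lemma r_inj: "inj_on r {..<4}"
  using r_neq by (auto intro!: inj_onI)

lemma L_other: "i < 4 \<Longrightarrow> j < 4 \<Longrightarrow> i \<noteq> j \<Longrightarrow> poly (L i) (r j) = 0"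
  by (auto simp: L_def poly_prod)

lemma degree_L: "i < 4 \<Longrightarrow> degree (L i) = 3"
  unfolding L_def by (subst degree_prod_eq_sum_degree) auto

lemma Delta_eq: "\<Delta> i = (\<Prod>j\<in>{..<4} - {i}. r i - r j)"
  by (simp add: \<Delta>_def L_def poly_prod)

lemma Delta_neq_0: "i < 4 \<Longrightarrow> \<Delta> i \<noteq> 0"
  using r_neq by (auto simp: Delta_eq)

lemma multiplicity_Delta:
  assumes "i < 4"
  shows "multiplicity 3 (\<Delta> i) \<le> 3 * B"
proof -
  have "multiplicity 3 (\<Delta> i) = (\<Sum>j\<in>{..<4} - {i}. multiplicity 3 (r i - r j))"
    unfolding Delta_eq
    by (rule prime_elem_multiplicity_prod_distrib) (use r_neq[OF assms] in \<open>force+\<close>)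
  also have "\<dots> \<le> (\<Sum>j\<in>{..<4} - {i}. B)"
  proof (rule sum_mono)
    fix j assume "j \<in> {..<4} - {i}"
    then have "\<not> 3 ^ Suc B dvd r i - r j" using r_sep[of i j] assms by auto
    then show "multiplicity 3 (r i - r j) \<le> B"
      by (meson multiplicity_dvd' not_less_eq_eq)
  qed
  also have "\<dots> = 3 * B" using assms by simp
  finally show ?thesis .
qed

lemma multiplicity_prod_Delta:
  shows "multiplicity 3 (\<Prod>i<4. \<Delta> i) \<le> 12 * B" and "(\<Prod>i<4. \<Delta> i) \<noteq> 0"
proof -
  show "(\<Prod>i<4. \<Delta> i) \<noteq> 0" using Delta_neq_0 by auto
  have "multiplicity 3 (\<Prod>i<4. \<Delta> i) = (\<Sum>i<4. multiplicity 3 (\<Delta> i))"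
    by (rule prime_elem_multiplicity_prod_distrib) (use Delta_neq_0 in \<open>force+\<close>)
  also have "\<dots> \<le> (\<Sum>i<4 :: nat. 3 * B)"
    by (rule sum_mono) (use multiplicity_Delta in auto)
  finally show "multiplicity 3 (\<Prod>i<4. \<Delta> i) \<le> 12 * B" by simp
qed

text \<open>Lagrange interpolation at the \<open>r i\<close>, multiplied by all four denominators so
  that it stays over the integers. Both sides have degree at most 3 and agree at four
  points.\<close>

lemma lagrange:
  assumes "degree t < 4"
  shows "Polynomial.smult (\<Prod>i<4. \<Delta> i) t
    = (\<Sum>i<4. Polynomial.smult (poly t (r i) * (\<Prod>j\<in>{..<4} - {i}. \<Delta> j)) (L i))"
    (is "?p = ?q")
proof (rule poly_eqI_degree[of "r ` {..<4}"])
  have card: "card (r ` {..<4}) = 4" by (simp add: card_image r_inj)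
  show "degree ?p < card (r ` {..<4})"
    unfolding card using assms degree_smult_le[of "\<Prod>i<4. \<Delta> i" t] by linarith
  have "degree ?q \<le> 3"
    by (intro degree_sum_le order.trans[OF degree_smult_le]) (auto simp: degree_L)
  then show "degree ?q < card (r ` {..<4})" unfolding card by simp
  fix x assume "x \<in> r ` {..<4}"
  then obtain j where j: "j < 4" "x = r j" by auto
  have "poly ?q x = (\<Sum>i<4. if i = j then poly t (r j) * (\<Prod>j'\<in>{..<4} - {j}. \<Delta> j') * \<Delta> j else 0)"
    unfolding poly_sum by (rule sum.cong) (use j L_other in \<open>auto simp: \<Delta>_def\<close>)
  also have "\<dots> = poly t (r j) * ((\<Prod>j'\<in>{..<4} - {j}. \<Delta> j') * \<Delta> j)"
    using j by simp
  also have "(\<Prod>j'\<in>{..<4} - {j}. \<Delta> j') * \<Delta> j = (\<Prod>i<4. \<Delta> i)"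
    using j by (subst prod.remove[of "{..<4}" j]) auto
  finally show "poly ?p x = poly ?q x" by (simp add: j)
qed

text \<open>The remainder of \<open>g\<close> modulo \<open>F\<close> is also small at the
  approximate roots, and interpolation recovers its coefficients up to the product of the
  \<open>\<Delta> i\<close>. That product accounts for the loss of \<open>12 * B\<close>: four
  factors of valuation at most \<open>3 * B\<close>.\<close>

lemma vanishing_imp_divisible:
  assumes g: "\<And>i. i < 4 \<Longrightarrow> 3 ^ M dvd poly g (r i)"
  obtains q where "ip g \<alpha> = 3 ^ (M - 12 * B) * ip q \<alpha>"
proof -
  obtain s and t :: "nat \<Rightarrow> int" where st: "g = F * s + [:t 0, t 1, t 2, t 3:]"
    using reduce_mod_F by blast
  let ?t = "[:t 0, t 1, t 2, t 3:]"
  have t: "3 ^ M dvd poly ?t (r i)" if "i < 4" for i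
  proof -
    have "poly ?t (r i) = poly g (r i) - poly F (r i) * poly s (r i)"
      by (simp add: st)
    then show ?thesis using g[OF that] r_root[OF that] by (simp add: dvd_diff)
  qed
  have "3 ^ M dvd (\<Prod>i<4. \<Delta> i) * coeff ?t n" for n
  proof -
    have degt: "degree ?t < 4" by (simp add: degree_pCons_eq_if)
    have "(\<Prod>i<4. \<Delta> i) * coeff ?t n
      = coeff (\<Sum>i<4. Polynomial.smult (poly ?t (r i) * (\<Prod>j\<in>{..<4} - {i}. \<Delta> j)) (L i)) n"
      by (simp only: lagrange[OF degt, symmetric] coeff_smult)
    also have "3 ^ M dvd \<dots>"
      unfolding coeff_sum by (intro dvd_sum) (use t in \<open>auto intro!: dvd_mult2 simp del: poly_pCons\<close>)
    finally show ?thesis .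
  qed
  then have "3 ^ (M - 12 * B) dvd coeff ?t n" for n
    using pow_3_dvd_cancel multiplicity_prod_Delta by blast
  from this[of 0] this[of 1] this[of 2] this[of 3]
  have "3 ^ (M - 12 * B) dvd t 0" "3 ^ (M - 12 * B) dvd t 1" "3 ^ (M - 12 * B) dvd t 2" "3 ^ (M - 12 * B) dvd t 3"
    by (simp_all add: coeff_pCons eval_nat_numeral One_nat_def)
  then obtain q0 q1 q2 q3 where "t 0 = 3 ^ (M - 12 * B) * q0" "t 1 = 3 ^ (M - 12 * B) * q1"
    "t 2 = 3 ^ (M - 12 * B) * q2" "t 3 = 3 ^ (M - 12 * B) * q3"
    by (auto elim!: dvdE)
  then have "?t = Polynomial.smult (3 ^ (M - 12 * B)) [:q0, q1, q2, q3:]" by simp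
  then have "ip g \<alpha> = 3 ^ (M - 12 * B) * ip [:q0, q1, q2, q3:] \<alpha>"
    unfolding st by (simp only: of_int_poly_hom.hom_add of_int_poly_hom.hom_mult alpha_root
        of_int_hom.map_poly_hom_smult poly_add poly_mult poly_smult of_int_power of_int_numeral) simp
  then show ?thesis by (rule that)
qed

text \<open>An integer version of 3^(3B) / \<Delta> i. The exponent bounds all four valuations, so
  one scale serves every \<open>i\<close>.\<close>

definition u :: "nat \<Rightarrow> int" where
  "u i = (SOME v. 3 ^ M dvd v * \<Delta> i - 3 ^ (3 * B))"

lemma u: "i < 4 \<Longrightarrow> 3 ^ M dvd u i * \<Delta> i - 3 ^ (3 * B)"
  unfolding u_def
  by (rule someI_ex) (metis pow_3_inverse Delta_neq_0 multiplicity_Delta)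

definition P :: "nat \<Rightarrow> int poly" where
  "P i = Polynomial.smult (u i) (L i)"

lemma P_same: "i < 4 \<Longrightarrow> 3 ^ M dvd poly (P i) (r i) - 3 ^ (3 * B)"
  using u by (simp add: P_def \<Delta>_def)

lemma P_other: "i < 4 \<Longrightarrow> j < 4 \<Longrightarrow> i \<noteq> j \<Longrightarrow> poly (P i) (r j) = 0"
  by (simp add: P_def L_other)

definition E :: "nat \<Rightarrow> complex" where
  "E i = ip (P i) \<alpha> / 3 ^ (3 * B)"

lemma ip_P: "ip (P i) \<alpha> = 3 ^ (3 * B) * E i"
  by (simp add: E_def)

lemma E_field_gen: "E i \<in> field_gen \<alpha>"
  by (rule field_gen_divide_int[of "3 ^ (3 * B)"])
     (simp_all add: field_gen_ip field_gen_closed flip: ip_P)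

text \<open>Interpolation loses \<open>12 * B\<close> in the exponent, and each of the two
  denominators in a product of idempotents another \<open>3 * B\<close>. With
  \<open>18 * B + T\<close> a factor \<open>3 ^ T\<close> survives.\<close>

context
  fixes T :: nat
  assumes M: "M = 18 * B + T"
begin

lemma pow_M: "(3 :: complex) ^ (M - 12 * B) = 3 ^ (3 * B) * 3 ^ (3 * B) * 3 ^ T"
  using M by (simp flip: power_add)

lemma E_orthogonal:
  assumes "i < 4" "j < 4" "i \<noteq> j"
  obtains q where "E i * E j = 3 ^ T * ip q \<alpha>"
proof -
  have "3 ^ M dvd poly (P i * P j) (r l)" if "l < 4" for l
    using assms that P_other[of i l] P_other[of j l] by (cases "l = i") auto
  then obtain q where q: "ip (P i * P j) \<alpha> = 3 ^ (M - 12 * B) * ip q \<alpha>"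
    using vanishing_imp_divisible by blast
  have "(3 ^ (3 * B) * 3 ^ (3 * B)) * (E i * E j) = (3 ^ (3 * B) * 3 ^ (3 * B)) * (3 ^ T * ip q \<alpha>)"
    using q unfolding pow_M by (simp add: of_int_poly_hom.hom_mult ip_P mult_ac)
  then show ?thesis using that by simp
qed

lemma E_idempotent:
  assumes "i < 4"
  obtains q where "E i * E i - E i = 3 ^ T * ip q \<alpha>"
proof -
  let ?g = "P i * P i - Polynomial.smult (3 ^ (3 * B)) (P i)"
  have "3 ^ M dvd poly ?g (r l)" if "l < 4" for l
  proof (cases "l = i")
    case True
    have "poly ?g (r i) = poly (P i) (r i) * (poly (P i) (r i) - 3 ^ (3 * B))"
      by (simp add: algebra_simps)
    then show ?thesis using P_same[OF assms] True by simp
  next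
    case False
    then show ?thesis using P_other[of i l] assms that by simp
  qed
  then obtain q where q: "ip ?g \<alpha> = 3 ^ (M - 12 * B) * ip q \<alpha>"
    using vanishing_imp_divisible by blast
  have "(3 ^ (3 * B) * 3 ^ (3 * B)) * (E i * E i - E i) = (3 ^ (3 * B) * 3 ^ (3 * B)) * (3 ^ T * ip q \<alpha>)"
    using q unfolding pow_M by (simp add: of_int_poly_hom.hom_mult of_int_poly_hom.hom_minus
        of_int_hom.map_poly_hom_smult ip_P algebra_simps)
  then show ?thesis using that by simp
qed

lemma E_total:
  obtains q where "(\<Sum>i<4. E i) - 1 = 3 ^ T * ip q \<alpha>"
proof -
  let ?g = "(\<Sum>i<4. P i) - [:3 ^ (3 * B):]"
  have "3 ^ M dvd poly ?g (r l)" if "l < 4" for l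
  proof -
    have "(\<Sum>i<4. poly (P i) (r l)) = (\<Sum>i<4. if i = l then poly (P l) (r l) else 0)"
      by (rule sum.cong) (use that P_other in auto)
    then show ?thesis using P_same[OF that] that by (simp add: poly_sum)
  qed
  then obtain q where q: "ip ?g \<alpha> = 3 ^ (M - 12 * B) * ip q \<alpha>"
    using vanishing_imp_divisible by blast
  have "3 ^ (3 * B) * ((\<Sum>i<4. E i) - 1) = 3 ^ (3 * B) * (3 ^ T * (3 ^ (3 * B) * ip q \<alpha>))"
    using q unfolding pow_M by (simp add: of_int_poly_hom.hom_minus of_int_poly_hom.hom_sum poly_sum
        of_int_hom.map_poly_pCons_hom ip_P sum_distrib_left algebra_simps)
  then have "(\<Sum>i<4. E i) - 1 = 3 ^ T * ip (Polynomial.smult (3 ^ (3 * B)) q) \<alpha>"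
    by (simp add: of_int_hom.map_poly_hom_smult)
  then show ?thesis by (rule that)
qed

text \<open>The coordinates in powers of \<alpha> may have denominators; integrality comes from the
  monic equation X^2 - X = 3^T q(\<alpha>), whose right side is integral.\<close>

lemma E_integer:
  assumes "i < 4"
  shows "E i \<in> ring_of_integers \<alpha>"
proof -
  obtain q where q: "E i * E i - E i = 3 ^ T * ip q \<alpha>"
    using E_idempotent[OF assms] by blast
  have "algebraic_int (3 ^ T * ip q \<alpha>)"
    using pow_3_ip_alpha_integer by (simp add: ring_of_integers_def)
  then have "algebraic_int (E i)"
    by (rule algebraic_int_root[of _ "[:0, -1, 1:]"])
       (use q in \<open>auto simp: coeff_pCons algebra_simps split: nat.splits\<close>)
  then show ?thesis by (simp add: ring_of_integers_def E_field_gen)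
qed

text \<open>If 3^n divides \<open>E i\<close> with 0 < n < T, then 3^(n+1) divides
  \<open>E i * E i - 3 ^ T * ip q \<alpha>\<close>, which is \<open>E i\<close>. So divisibility by
  3 propagates to 3^T, and this is incompatible with the bounded denominator
  \<open>D\<close>.\<close>

lemma E_not_divisible:
  fixes D :: int
  assumes i: "i < 4" and z: "z \<in> ring_of_integers \<alpha>" and T: "\<not> 3 ^ T dvd D"
    and D: "\<And>x. x \<in> ring_of_integers \<alpha> \<Longrightarrow> \<exists>w :: nat \<Rightarrow> int. of_int D * x = (\<Sum>i<4. of_int (w i) * \<alpha> ^ i)"
  shows "E i \<noteq> 3 * z"
proof
  assume E3: "E i = 3 * z"
  obtain q where q: "E i * E i - E i = 3 ^ T * ip q \<alpha>"
    using E_idempotent[OF i] by blast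
  have "\<exists>z\<in>ring_of_integers \<alpha>. E i = 3 ^ Suc n * z" if "Suc n \<le> T" for n
    using that
  proof (induction n)
    case 0
    then show ?case using z E3 by auto
  next
    case (Suc n)
    then obtain z where z: "z \<in> ring_of_integers \<alpha>" "E i = 3 ^ Suc n * z" by auto
    have T': "T = Suc (Suc n) + (T - Suc (Suc n))" using Suc.prems by simp
    have "E i = E i * E i - 3 ^ T * ip q \<alpha>" using q by (simp add: algebra_simps)
    also have "\<dots> = 3 ^ Suc n * z * (3 ^ Suc n * z) - 3 ^ (Suc (Suc n) + (T - Suc (Suc n))) * ip q \<alpha>"
      unfolding T'[symmetric] by (simp add: z(2))
    also have "\<dots> = 3 ^ Suc (Suc n) * (3 ^ n * z * z - 3 ^ (T - Suc (Suc n)) * ip q \<alpha>)"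
      unfolding power_add by (simp add: algebra_simps)
    finally have "E i = 3 ^ Suc (Suc n) * (3 ^ n * z * z - 3 ^ (T - Suc (Suc n)) * ip q \<alpha>)" .
    moreover have "3 ^ n \<in> ring_of_integers \<alpha>"
      using pow_3_ip_alpha_integer[of n 1] by simp
    then have "3 ^ n * z * z - 3 ^ (T - Suc (Suc n)) * ip q \<alpha> \<in> ring_of_integers \<alpha>"
      by (intro ring_of_integers_closed(2,3) z(1) pow_3_ip_alpha_integer)
    ultimately show ?case by blast
  qed
  moreover have "T \<noteq> 0" using T by (metis one_dvd power_0)
  ultimately obtain z where z: "z \<in> ring_of_integers \<alpha>" "E i = 3 ^ T * z"
    by (metis Suc_pred order_refl neq0_conv)
  obtain w :: "nat \<Rightarrow> int" where w: "of_int D * z = (\<Sum>i<4. of_int (w i) * \<alpha> ^ i)"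
    using D[OF z(1)] by blast
  let ?w = "[:w 0, w 1, w 2, w 3:]"
  have "of_int D * ip (P i) \<alpha> = 3 ^ (3 * B + T) * (of_int D * z)"
    unfolding ip_P z(2) by (simp add: power_add mult_ac)
  also have "\<dots> = 3 ^ (3 * B + T) * ip ?w \<alpha>"
    unfolding w ip_pCons4 ..
  finally have "ip (Polynomial.smult D (P i) - Polynomial.smult (3 ^ (3 * B + T)) ?w) \<alpha> = 0"
    by (simp only: of_int_poly_hom.hom_minus of_int_hom.map_poly_hom_smult poly_diff poly_smult
        of_int_power of_int_numeral) simp
  moreover have "degree (Polynomial.smult D (P i) - Polynomial.smult (3 ^ (3 * B + T)) ?w) \<le> 3"
  proof (rule degree_diff_le)
    show "degree (Polynomial.smult D (P i)) \<le> 3"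
      unfolding P_def by (simp add: degree_L[OF i])
    show "degree (Polynomial.smult (3 ^ (3 * B + T)) ?w) \<le> 3"
      by (rule order.trans[OF degree_smult_le]) (simp add: degree_pCons_eq_if)
  qed
  \<comment> \<open>In degree below 4 a relation at \<alpha> is an identity of polynomials, so it
    may be evaluated at \<open>r i\<close>, where \<open>P i\<close> is \<open>3 ^ (3 * B)\<close>
    modulo \<open>3 ^ M\<close>.\<close>
  ultimately have "Polynomial.smult D (P i) - Polynomial.smult (3 ^ (3 * B + T)) ?w = 0"
    by (intro ip_eq_0_imp) auto
  then have "poly (Polynomial.smult D (P i)) (r i) = poly (Polynomial.smult (3 ^ (3 * B + T)) ?w) (r i)"
    by simp
  then have "3 ^ (3 * B + T) dvd D * poly (P i) (r i)"
    by (simp only: poly_smult) simp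
  moreover have "3 ^ (3 * B + T) dvd D * (poly (P i) (r i) - 3 ^ (3 * B))"
    using dvd_trans[OF le_imp_power_dvd P_same[OF i], of "3 * B + T"] M by simp
  ultimately have "3 ^ (3 * B + T) dvd D * poly (P i) (r i) - D * (poly (P i) (r i) - 3 ^ (3 * B))"
    by (rule dvd_diff)
  then have "3 ^ (3 * B) * 3 ^ T dvd 3 ^ (3 * B) * D"
    by (simp add: algebra_simps power_add)
  then show False using T by simp
qed

end

end

section \<open>The index of a quartic field that splits completely at 3\<close>

context quartic_root
begin

lemma ring_index_eq:
  assumes "\<theta> \<in> ring_of_integers \<alpha>"
  shows "ring_index \<alpha> \<theta> = card (add_cosets (ring_of_integers \<alpha>) (Zring \<theta>))"
proof -
  have "Zring \<theta> \<subseteq> ring_of_integers \<alpha>"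
    using assms by (auto simp: Zring_def ring_of_integers_def field_gen_ip algebraic_int_ip)
  moreover have "add_subgroup (ring_of_integers \<alpha>)"
    using ring_of_integers_closed(2)[OF ring_of_integers_closed(1) ring_of_integers_closed(1)]
    by (simp add: add_subgroup_def ring_of_integers_closed)
  ultimately show ?thesis
    unfolding ring_index_def by (simp add: quotient_eq_add_cosets add_subgroup_Zring)
qed

theorem common_index_if_splits:
  assumes split: "\<And>M. \<exists>r :: nat \<Rightarrow> int. (\<forall>i<4. 3 ^ M dvd poly [:c, b, 0, a, 1:] (r i)) \<and>
    (\<forall>i<4. \<forall>j<4. i \<noteq> j \<longrightarrow> \<not> 3 ^ Suc B dvd r i - r j)"
  shows "3 dvd common_index \<alpha> \<and> multiplicity 3 (common_index \<alpha>) = 1 \<and> \<not> monogenic \<alpha>"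
proof -
  obtain D :: int where D0: "D \<noteq> 0"
    and D: "\<And>x. x \<in> ring_of_integers \<alpha> \<Longrightarrow> \<exists>w :: nat \<Rightarrow> int. of_int D * x = (\<Sum>i<4. of_int (w i) * \<alpha> ^ i)"
    using bounded_denominator by blast
  \<comment> \<open>Exceeding the valuation of \<open>D\<close> keeps \<open>3 ^ T\<close> from
    dividing it; the summand 2 also lets a factor 9 be split off.\<close>
  define T where "T = multiplicity 3 D + 2"
  have T: "\<not> 3 ^ T dvd D"
    using D0 by (subst power_dvd_iff_le_multiplicity) (auto simp: T_def)
  obtain r :: "nat \<Rightarrow> int" where r: "\<forall>i<4. 3 ^ (18 * B + T) dvd poly [:c, b, 0, a, 1:] (r i)"
    "\<forall>i<4. \<forall>j<4. i \<noteq> j \<longrightarrow> \<not> 3 ^ Suc B dvd r i - r j"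
    using split by blast
  interpret A: quartic_approx a b c \<alpha> r B "18 * B + T"
    by unfold_locales (use r in \<open>auto simp: F_def simp del: poly_pCons\<close>)
  let ?O = "ring_of_integers \<alpha>"
  have T9: "3 ^ T * ip q \<alpha> = 9 * (3 ^ (T - 2) * ip q \<alpha>)" for q
    by (simp add: T_def power_add)
  interpret I: idempotents_mod_9 ?O A.E
  proof
    show "\<exists>z\<in>?O. A.E i * A.E j = (if i = j then A.E i else 0) + 9 * z" if ij: "i < 4" "j < 4" for i j
    proof (cases "i = j")
      case True
      obtain q where "A.E i * A.E i - A.E i = 3 ^ T * ip q \<alpha>"
        using A.E_idempotent[OF refl ij(1)] by blast
      then have "A.E i * A.E i = A.E i + 9 * (3 ^ (T - 2) * ip q \<alpha>)"
        unfolding T9 by (simp add: algebra_simps)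
      then show ?thesis using True pow_3_ip_alpha_integer by auto
    next
      case False
      obtain q where "A.E i * A.E j = 3 ^ T * ip q \<alpha>"
        using A.E_orthogonal[OF refl ij False] by blast
      then show ?thesis using False pow_3_ip_alpha_integer unfolding T9 by auto
    qed
    obtain q where "(\<Sum>i<4. A.E i) - 1 = 3 ^ T * ip q \<alpha>"
      using A.E_total[OF refl] by blast
    then have "(\<Sum>i<4. A.E i) = 1 + 9 * (3 ^ (T - 2) * ip q \<alpha>)"
      unfolding T9 by (simp add: algebra_simps)
    then show "\<exists>z\<in>?O. (\<Sum>i<4. A.E i) = 1 + 9 * z"
      using pow_3_ip_alpha_integer by blast
    show "A.E i \<noteq> 3 * z" if "i < 4" "z \<in> ?O" for i z
      using A.E_not_divisible[OF refl that T D] .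
  qed (auto intro: ring_of_integers_closed A.E_integer[OF refl])
  interpret J: idempotent_basis_mod_9 ?O A.E
  proof
    fix x assume "x \<in> ?O"
    then have "x \<in> field_gen \<alpha>" by (simp add: ring_of_integers_def)
    moreover have "int_independent A.E"
      unfolding int_independent_def using I.E_independent by blast
    ultimately show "\<exists>d k. d \<noteq> 0 \<and> of_int d * x = (\<Sum>i<4. of_int (k i) * A.E i)"
      using independent_imp_basis[of A.E x] A.E_field_gen by blast
  qed
  let ?\<theta> = "J.gen"
  have \<theta>K: "?\<theta> \<in> field_gen \<alpha>"
    using J.gen_closed by (simp add: ring_of_integers_def)
  have ind: "int_independent (\<lambda>i. ?\<theta> ^ i)"
    unfolding int_independent_def using J.gen_powers_independent by blast
  have gen: "field_gen ?\<theta> = field_gen \<alpha>"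
  proof (intro equalityI field_gen_mono \<theta>K)
    obtain d :: int and k :: "nat \<Rightarrow> int"
      where d: "d \<noteq> 0" "of_int d * \<alpha> = (\<Sum>i<4. of_int (k i) * ?\<theta> ^ i)"
      using independent_imp_basis[OF ind, of \<alpha>] field_gen_power[OF \<theta>K] field_gen_closed(2) by blast
    have "of_int d * \<alpha> \<in> field_gen ?\<theta>"
      unfolding d(2) by (intro field_gen_sum field_gen_closed field_gen_of_int field_gen_power)
    then show "\<alpha> \<in> field_gen ?\<theta>" using d(1) field_gen_divide_int by blast
  qed
  have mult: "multiplicity 3 (ring_index \<alpha> ?\<theta>) = 1"
    unfolding ring_index_eq[OF J.gen_closed]
    by (rule J.multiplicity_3_card_cosets_gen[OF finite_index[OF \<theta>K ind]])
  have dvd: "3 dvd ring_index \<alpha> \<theta>" if "\<theta> \<in> ?O" for \<theta>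
    unfolding ring_index_eq[OF that] by (rule J.three_dvd_card_cosets[OF that])
  have "3 dvd common_index \<alpha>"
    unfolding common_index_def by (rule Gcd_greatest) (use dvd in auto)
  moreover have cdvd: "common_index \<alpha> dvd ring_index \<alpha> ?\<theta>"
    unfolding common_index_def by (rule Gcd_dvd) (use J.gen_closed gen in blast)
  moreover have nz: "ring_index \<alpha> ?\<theta> \<noteq> 0" using mult by (metis multiplicity_zero zero_neq_one)
  ultimately have "1 \<le> multiplicity 3 (common_index \<alpha>)"
    by (subst power_dvd_iff_le_multiplicity[symmetric]) auto
  then have "multiplicity 3 (common_index \<alpha>) = 1"
    using mult dvd_imp_multiplicity_le[OF cdvd, of 3] nz by simp
  moreover have "\<not> monogenic \<alpha>"
  proof
    assume "monogenic \<alpha>"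
    then obtain \<theta> where \<theta>: "\<theta> \<in> ?O" "?O = Zring \<theta>" by (auto simp: monogenic_def)
    have "(+) x ` ?O = ?O" if "x \<in> ?O" for x
      using add_coset_eq_iff[OF J.add_subgroup_R, of x 0] that by simp
    then have "add_cosets ?O ?O = {?O}"
      using I.one_closed by (auto simp: add_cosets_def)
    then have "ring_index \<alpha> \<theta> = 1"
      using ring_index_eq[OF \<theta>(1)] \<theta>(2) by simp
    then show False using dvd[OF \<theta>(1)] by simp
  qed
  ultimately show ?thesis using \<open>3 dvd common_index \<alpha>\<close> by blast
qed

end

section \<open>Hensel lifting\<close>

lemma int_poly_taylor:
  fixes f :: "int poly"
  shows "\<exists>q. poly f (x + h) = poly f x + h * poly (pderiv f) x + h ^ 2 * q"
proof (induction f)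
  case (pCons k f)
  then obtain q where q: "poly f (x + h) = poly f x + h * poly (pderiv f) x + h ^ 2 * q"
    by blast
  show ?case
    by (intro exI[of _ "poly (pderiv f) x + (x + h) * q"])
       (simp only: poly_pCons pderiv_pCons poly_add q, simp add: algebra_simps power2_eq_square)
qed simp

lemma int_poly_diff_dvd: "x - y dvd poly f x - poly f (y :: int)"
proof -
  obtain q where "poly f (y + (x - y)) = poly f y + (x - y) * poly (pderiv f) y + (x - y) ^ 2 * q"
    using int_poly_taylor by blast
  then have "poly f x - poly f y = (x - y) * (poly (pderiv f) y + (x - y) * q)"
    by (simp add: algebra_simps power2_eq_square)
  then show ?thesis by simp
qed

text \<open>Newton iteration: the derivative keeps its residue along the way, and the correction
  \<open>- poly f z * u\<close>, with \<open>u\<close> its inverse modulo 3, gains a factor 3 in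
  each step.\<close>

lemma hensel_3:
  fixes f :: "int poly"
  assumes "3 dvd poly f z0" and "\<not> 3 dvd poly (pderiv f) z0"
  shows "\<exists>z. 3 dvd z - z0 \<and> 3 ^ M dvd poly f z"
proof -
  have "\<exists>z. 3 dvd z - z0 \<and> 3 ^ Suc M dvd poly f z"
  proof (induction M)
    case 0
    then show ?case using assms(1) by (intro exI[of _ z0]) auto
  next
    case (Suc M)
    then obtain z where z: "3 dvd z - z0" "3 ^ Suc M dvd poly f z" by blast
    then obtain k where k: "poly f z = 3 ^ Suc M * k" by blast
    have "3 dvd poly (pderiv f) z - poly (pderiv f) z0"
      using z(1) int_poly_diff_dvd dvd_trans by blast
    then have "\<not> 3 dvd poly (pderiv f) z"
      using assms(2) by presburger
    then obtain u v where uv: "poly (pderiv f) z * u + 3 * v = 1"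
      using bezout_mod_3 by blast
    define h where "h = 3 ^ Suc M * (- k * u)"
    obtain q where "poly f (z + h) = poly f z + h * poly (pderiv f) z + h ^ 2 * q"
      using int_poly_taylor by blast
    also have "\<dots> = 3 ^ Suc M * k * (1 - poly (pderiv f) z * u) + h ^ 2 * q"
      by (simp add: k h_def algebra_simps)
    also have "1 - poly (pderiv f) z * u = 3 * v" using uv by simp
    finally have "poly f (z + h) = 3 ^ Suc (Suc M) * (k * v + 3 ^ M * (k * u) ^ 2 * q)"
      by (simp add: h_def algebra_simps power2_eq_square)
    then have "3 ^ Suc (Suc M) dvd poly f (z + h)" by simp
    moreover have "3 dvd z + h - z0"
    proof -
      have "3 dvd h" by (simp add: h_def)
      then show ?thesis using z(1) by presburger
    qed
    ultimately show ?case by blast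
  qed
  then show ?thesis
    by (metis dvd_trans le_imp_power_dvd lessI less_imp_le_nat)
qed

text \<open>The derivative condition is already reduced modulo 3: 4 becomes 1, and the term with
  \<open>g3\<close> drops out. A general leading coefficient is allowed because rescaled polynomials
  are not monic.\<close>

lemma hensel_quartic:
  fixes g0 g1 g2 g3 g4 :: int
  assumes "3 dvd g4 * z0 ^ 4 + g3 * z0 ^ 3 + g2 * z0 ^ 2 + g1 * z0 + g0"
    and "\<not> 3 dvd g4 * z0 ^ 3 + 2 * g2 * z0 + g1"
  obtains z where "3 dvd z - z0" and "3 ^ M dvd g4 * z ^ 4 + g3 * z ^ 3 + g2 * z ^ 2 + g1 * z + g0"
proof -
  let ?f = "[:g0, g1, g2, g3, g4:]"
  have f: "poly ?f z = g4 * z ^ 4 + g3 * z ^ 3 + g2 * z ^ 2 + g1 * z + g0" for z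
    by (simp add: algebra_simps eval_nat_numeral)
  have "poly (pderiv ?f) z0 = g4 * z0 ^ 3 + 2 * g2 * z0 + g1 + 3 * (g4 * z0 ^ 3 + g3 * z0 ^ 2)"
    by (simp add: pderiv_pCons algebra_simps eval_nat_numeral)
  then have "\<not> 3 dvd poly (pderiv ?f) z0"
    using assms(2) by (metis dvd_add_left_iff dvd_triv_left)
  moreover have "3 dvd poly ?f z0" using assms(1) by (simp only: f)
  ultimately show ?thesis
    using hensel_3[of ?f z0 M] that unfolding f by blast
qed

lemma not_pow_3_dvd:
  fixes w :: int
  assumes "\<not> 3 dvd w"
  shows "\<not> 3 ^ Suc h dvd 3 ^ h * w"
  using assms by (simp only: power_Suc2 dvd_mult_cancel_left) simp

text \<open>The order of the quantifiers matters: the separation \<open>B\<close> is fixed before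
  the precision \<open>M\<close>.\<close>

definition splits_at_3 :: "int \<Rightarrow> int \<Rightarrow> int \<Rightarrow> bool" where
  "splits_at_3 a b c \<longleftrightarrow> (\<exists>B. \<forall>M. \<exists>r :: nat \<Rightarrow> int. (\<forall>i<4. 3 ^ M dvd poly [:c, b, 0, a, 1:] (r i)) \<and>
    (\<forall>i<4. \<forall>j<4. i \<noteq> j \<longrightarrow> \<not> 3 ^ Suc B dvd r i - r j))"

lemma poly_F: "poly [:c, b, 0, a, 1:] x = x ^ 4 + a * x ^ 3 + b * x + (c :: int)"
  by (simp add: algebra_simps eval_nat_numeral)

lemma splits_at_3I:
  assumes "\<And>M. \<exists>r0 r1 r2 r3. 3 ^ M dvd r0 ^ 4 + a * r0 ^ 3 + b * r0 + c \<and> 3 ^ M dvd r1 ^ 4 + a * r1 ^ 3 + b * r1 + c \<and>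
      3 ^ M dvd r2 ^ 4 + a * r2 ^ 3 + b * r2 + c \<and> 3 ^ M dvd r3 ^ 4 + a * r3 ^ 3 + b * r3 + c \<and>
      \<not> 3 ^ Suc B dvd r0 - r1 \<and> \<not> 3 ^ Suc B dvd r0 - r2 \<and> \<not> 3 ^ Suc B dvd r0 - r3 \<and>
      \<not> 3 ^ Suc B dvd r1 - r2 \<and> \<not> 3 ^ Suc B dvd r1 - r3 \<and> \<not> 3 ^ Suc B dvd r2 - r3"
  shows "splits_at_3 a b c"
  unfolding splits_at_3_def
proof (intro exI[of _ B] allI)
  fix M
  obtain r0 r1 r2 r3 where r: "3 ^ M dvd r0 ^ 4 + a * r0 ^ 3 + b * r0 + c" "3 ^ M dvd r1 ^ 4 + a * r1 ^ 3 + b * r1 + c"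
      "3 ^ M dvd r2 ^ 4 + a * r2 ^ 3 + b * r2 + c" "3 ^ M dvd r3 ^ 4 + a * r3 ^ 3 + b * r3 + c"
    and d: "\<not> 3 ^ Suc B dvd r0 - r1" "\<not> 3 ^ Suc B dvd r0 - r2" "\<not> 3 ^ Suc B dvd r0 - r3"
      "\<not> 3 ^ Suc B dvd r1 - r2" "\<not> 3 ^ Suc B dvd r1 - r3" "\<not> 3 ^ Suc B dvd r2 - r3"
    using assms[of M] by blast
  define r where "r = (\<lambda>i :: nat. if i = 0 then r0 else if i = 1 then r1 else if i = 2 then r2 else r3)"
  have lt4: "i < 4 \<longleftrightarrow> i = 0 \<or> i = 1 \<or> i = 2 \<or> i = 3" for i :: nat by auto
  have d': "\<not> 3 ^ Suc B dvd r1 - r0" "\<not> 3 ^ Suc B dvd r2 - r0" "\<not> 3 ^ Suc B dvd r3 - r0"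
      "\<not> 3 ^ Suc B dvd r2 - r1" "\<not> 3 ^ Suc B dvd r3 - r1" "\<not> 3 ^ Suc B dvd r3 - r2"
    using d dvd_diff_commute by blast+
  show "\<exists>r :: nat \<Rightarrow> int. (\<forall>i<4. 3 ^ M dvd poly [:c, b, 0, a, 1:] (r i)) \<and>
      (\<forall>i<4. \<forall>j<4. i \<noteq> j \<longrightarrow> \<not> 3 ^ Suc B dvd r i - r j)"
    unfolding poly_F lt4 using r d d'
    by (intro exI[of _ r]) (simp add: r_def del: power_Suc)
qed

text \<open>The substitution x -> -x changes the signs of \<open>a\<close> and \<open>b\<close> and
  reduces the case of a triple root 1 modulo 3 to that of a triple root -1.\<close>

lemma splits_at_3_uminus:
  assumes "splits_at_3 (- a) (- b) c"
  shows "splits_at_3 a b c"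
proof -
  obtain B where B: "\<exists>r :: nat \<Rightarrow> int. (\<forall>i<4. 3 ^ M dvd poly [:c, - b, 0, - a, 1:] (r i)) \<and>
    (\<forall>i<4. \<forall>j<4. i \<noteq> j \<longrightarrow> \<not> 3 ^ Suc B dvd r i - r j)" for M
    using assms unfolding splits_at_3_def by blast
  show ?thesis
    unfolding splits_at_3_def
  proof (intro exI[of _ B] allI)
    fix M
    obtain r :: "nat \<Rightarrow> int" where r: "\<And>i. i < 4 \<Longrightarrow> 3 ^ M dvd poly [:c, - b, 0, - a, 1:] (r i)"
      "\<And>i j. i < 4 \<Longrightarrow> j < 4 \<Longrightarrow> i \<noteq> j \<Longrightarrow> \<not> 3 ^ Suc B dvd r i - r j"
      using B[of M] by blast
    have "poly [:c, b, 0, a, 1:] (- x) = poly [:c, - b, 0, - a, 1:] x" for x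
      unfolding poly_F by simp
    moreover have "- r i - (- r j) = r j - r i" for i j by simp
    ultimately show "\<exists>r :: nat \<Rightarrow> int. (\<forall>i<4. 3 ^ M dvd poly [:c, b, 0, a, 1:] (r i)) \<and>
        (\<forall>i<4. \<forall>j<4. i \<noteq> j \<longrightarrow> \<not> 3 ^ Suc B dvd r i - r j)"
      using r by (intro exI[of _ "\<lambda>i. - r i"]) (simp del: power_Suc poly_pCons)
  qed
qed

lemma dvd_scaled: "3 ^ M dvd (G :: int) \<Longrightarrow> x = 3 ^ n * G \<Longrightarrow> 3 ^ M dvd x"
  by simp

text \<open>The substitution \<open>x = 3\<^sup>h z\<close> turns the factor \<open>x\<^sup>3\<close> of \<open>F\<close> modulo 3 into \<open>z\<^sup>3 - z\<close>, up to a unit.\<close>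
lemma splits_case_1:
  fixes a b' c' :: int
  assumes a: "\<not> 3 dvd a" and h: "h \<ge> 1" and b': "3 dvd b' + a"
  shows "splits_at_3 a (3 ^ (2 * h) * b') (3 ^ (3 * h + 1) * c')"
    (is "splits_at_3 a ?b ?c")
proof (rule splits_at_3I[where B = h])
  fix M
  have h3: "3 dvd (3 :: int) ^ h" using h by simp
  have bc: "3 dvd ?b" "3 dvd ?c" using h by auto
  \<comment> \<open>Since \<open>b'\<close> is \<open>- a\<close> modulo 3, the second factor
    reduces to a(z^3 - z), with the simple roots 0, 1, -1.\<close>
  have eq: "(3 ^ h * z) ^ 4 + a * (3 ^ h * z) ^ 3 + ?b * (3 ^ h * z) + ?c
      = 3 ^ (3 * h) * (3 ^ h * z ^ 4 + a * z ^ 3 + 0 * z ^ 2 + b' * z + 3 * c')" for z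
    by (simp add: power_mult_distrib power_add power_mult algebra_simps eval_nat_numeral)
  have b3: "\<not> 3 dvd b'" using a b' by presburger
  have lift: "\<exists>z. 3 dvd z - z0 \<and> 3 ^ M dvd (3 ^ h * z) ^ 4 + a * (3 ^ h * z) ^ 3 + ?b * (3 ^ h * z) + ?c"
    if z0: "z0 \<in> {0, 1, - 1}" for z0
  proof -
    have "3 dvd 3 ^ h * z0 ^ 4 + a * z0 ^ 3 + 0 * z0 ^ 2 + b' * z0 + 3 * c'"
      using z0 h3 b' by (auto; presburger)
    moreover have "\<not> 3 dvd 3 ^ h * z0 ^ 3 + 2 * 0 * z0 + b'"
      using b3 h3 by (metis dvd_add_right_iff dvd_mult2 mult_zero_left mult_zero_right add_0_right)
    ultimately show ?thesis
      by (rule hensel_quartic[where M = M]) (use dvd_scaled[OF _ eq] in blast)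
  qed
  obtain z0 where z0: "3 dvd z0 - 0" "3 ^ M dvd (3 ^ h * z0) ^ 4 + a * (3 ^ h * z0) ^ 3 + ?b * (3 ^ h * z0) + ?c"
    using lift[of 0] by auto
  obtain z1 where z1: "3 dvd z1 - 1" "3 ^ M dvd (3 ^ h * z1) ^ 4 + a * (3 ^ h * z1) ^ 3 + ?b * (3 ^ h * z1) + ?c"
    using lift[of 1] by auto
  obtain z2 where z2: "3 dvd z2 - (- 1)" "3 ^ M dvd (3 ^ h * z2) ^ 4 + a * (3 ^ h * z2) ^ 3 + ?b * (3 ^ h * z2) + ?c"
    using lift[of "- 1"] by auto
  \<comment> \<open>The fourth root is the unit root: modulo 3, \<open>F\<close> is x^3 (x +
    a).\<close>
  have "1 * (- a) ^ 4 + a * (- a) ^ 3 + 0 * (- a) ^ 2 + ?b * (- a) + ?c = - (?b * a) + ?c"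
    by (simp add: eval_nat_numeral)
  then have "3 dvd 1 * (- a) ^ 4 + a * (- a) ^ 3 + 0 * (- a) ^ 2 + ?b * (- a) + ?c"
    using bc by (metis dvd_add dvd_minus_iff dvd_mult2)
  moreover have "\<not> 3 dvd 1 * (- a) ^ 3 + 2 * 0 * (- a) + ?b"
  proof
    assume "3 dvd 1 * (- a) ^ 3 + 2 * 0 * (- a) + ?b"
    then have "3 dvd (- a) ^ 3" using bc(1) by (metis dvd_add_left_iff mult_1 mult_zero_left mult_zero_right add_0_right)
    moreover have "prime (3 :: int)" by simp
    ultimately have "3 dvd - a" using prime_dvd_power by blast
    then show False using a by simp
  qed
  ultimately obtain x where x: "3 dvd x - (- a)" "3 ^ M dvd 1 * x ^ 4 + a * x ^ 3 + 0 * x ^ 2 + ?b * x + ?c"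
    by (rule hensel_quartic)
  have dz: "\<not> 3 ^ Suc h dvd 3 ^ h * z - 3 ^ h * z'" if "\<not> 3 dvd z - z'" for z z' :: int
    using not_pow_3_dvd[OF that, of h] by (simp add: right_diff_distrib)
  have dx: "\<not> 3 ^ Suc h dvd 3 ^ h * z - x" for z
  proof
    assume "3 ^ Suc h dvd 3 ^ h * z - x"
    then have "3 dvd 3 ^ h * z - x" by (metis dvd_mult_left power_Suc)
    moreover have "3 dvd 3 ^ h * z" using h3 by simp
    ultimately have "3 dvd x" by presburger
    then show False using x(1) a by presburger
  qed
  have "\<not> 3 dvd z0 - z1" "\<not> 3 dvd z0 - z2" "\<not> 3 dvd z1 - z2"
    using z0(1) z1(1) z2(1) by presburger+
  then show "\<exists>r0 r1 r2 r3. 3 ^ M dvd r0 ^ 4 + a * r0 ^ 3 + ?b * r0 + ?c \<and> 3 ^ M dvd r1 ^ 4 + a * r1 ^ 3 + ?b * r1 + ?c \<and>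
      3 ^ M dvd r2 ^ 4 + a * r2 ^ 3 + ?b * r2 + ?c \<and> 3 ^ M dvd r3 ^ 4 + a * r3 ^ 3 + ?b * r3 + ?c \<and>
      \<not> 3 ^ Suc h dvd r0 - r1 \<and> \<not> 3 ^ Suc h dvd r0 - r2 \<and> \<not> 3 ^ Suc h dvd r0 - r3 \<and>
      \<not> 3 ^ Suc h dvd r1 - r2 \<and> \<not> 3 ^ Suc h dvd r1 - r3 \<and> \<not> 3 ^ Suc h dvd r2 - r3"
    using x(2) z0(2) z1(2) z2(2) dz dx
    by (intro exI[of _ "3 ^ h * z0"] exI[of _ "3 ^ h * z1"] exI[of _ "3 ^ h * z2"] exI[of _ x]) simp
qed

section \<open>Triple root -1 modulo 3\<close>

lemma shifted_F:
  fixes a b c y :: int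
  shows "(y - 1) ^ 4 + a * (y - 1) ^ 3 + b * (y - 1) + c
    = y ^ 4 + (a - 4) * y ^ 3 + 3 * (2 - a) * y ^ 2 + (- 4 + 3 * a + b) * y + (1 - a - b + c)"
  by (simp add: algebra_simps eval_nat_numeral)

text \<open>With \<open>x = y - 1\<close>, the substitution \<open>y = 3z\<close> isolates the root of \<open>F\<close> near \<open>-4\<close>, and
  \<open>y = 3\<^sup>s z\<close> yields \<open>-z\<^sup>2 + \<beta>z + \<gamma>\<close> modulo 3 for the two roots closest to \<open>-1\<close>.\<close>
lemma splits_case_2_aux:
  fixes a b c \<beta> \<gamma> z1 z2 :: int
  assumes a: "3 dvd a" and s: "s \<ge> 2"
    and b1: "- 4 + 3 * a + b = 3 ^ (s + 1) * \<beta>" and b0: "1 - a - b + c = 3 ^ (2 * s + 1) * \<gamma>"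
    and z12: "\<not> 3 dvd z1 - z2"
    and z1: "3 dvd - (z1 ^ 2) + \<beta> * z1 + \<gamma>" "\<not> 3 dvd z1 + \<beta>"
    and z2: "3 dvd - (z2 ^ 2) + \<beta> * z2 + \<gamma>" "\<not> 3 dvd z2 + \<beta>"
  shows "splits_at_3 a b c"
proof (rule splits_at_3I[where B = s])
  fix M
  obtain s' where s': "s = s' + 2" using s by (metis add.commute le_Suc_ex)
  have eq: "(3 ^ s * z - 1) ^ 4 + a * (3 ^ s * z - 1) ^ 3 + b * (3 ^ s * z - 1) + c
      = 3 ^ (2 * s + 1) * (3 ^ (2 * s' + 3) * z ^ 4 + (a - 4) * 3 ^ (s' + 1) * z ^ 3 + (2 - a) * z ^ 2 + \<beta> * z + \<gamma>)" for z
    unfolding shifted_F b1 b0 s'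
    by (simp add: power_mult_distrib power_add power_mult algebra_simps eval_nat_numeral)
  have lift: "\<exists>z. 3 dvd z - z0 \<and> 3 ^ M dvd (3 ^ s * z - 1) ^ 4 + a * (3 ^ s * z - 1) ^ 3 + b * (3 ^ s * z - 1) + c"
    if z0: "3 dvd - (z0 ^ 2) + \<beta> * z0 + \<gamma>" "\<not> 3 dvd z0 + \<beta>" for z0
  proof -
    obtain a' where a': "a = 3 * a'" using a by blast
    have "3 ^ (2 * s' + 3) * z0 ^ 4 + (a - 4) * 3 ^ (s' + 1) * z0 ^ 3 + (2 - a) * z0 ^ 2 + \<beta> * z0 + \<gamma>
        = (- (z0 ^ 2) + \<beta> * z0 + \<gamma>) + 3 * (3 ^ (2 * s' + 2) * z0 ^ 4 + (a - 4) * 3 ^ s' * z0 ^ 3 + (1 - a') * z0 ^ 2)"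
      by (simp add: a' algebra_simps eval_nat_numeral)
    then have "3 dvd 3 ^ (2 * s' + 3) * z0 ^ 4 + (a - 4) * 3 ^ (s' + 1) * z0 ^ 3 + (2 - a) * z0 ^ 2 + \<beta> * z0 + \<gamma>"
      using z0(1) by (metis dvd_add dvd_triv_left)
    moreover have "3 ^ (2 * s' + 3) * z0 ^ 3 + 2 * (2 - a) * z0 + \<beta>
        = (z0 + \<beta>) + 3 * (3 ^ (2 * s' + 2) * z0 ^ 3 + (1 - 2 * a') * z0)"
      by (simp add: a' algebra_simps eval_nat_numeral)
    then have "\<not> 3 dvd 3 ^ (2 * s' + 3) * z0 ^ 3 + 2 * (2 - a) * z0 + \<beta>"
      using z0(2) by (metis dvd_add_left_iff dvd_triv_left)
    ultimately show ?thesis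
      by (rule hensel_quartic[where M = M]) (use dvd_scaled[OF _ eq] in blast)
  qed
  obtain w1 where w1: "3 dvd w1 - z1" "3 ^ M dvd (3 ^ s * w1 - 1) ^ 4 + a * (3 ^ s * w1 - 1) ^ 3 + b * (3 ^ s * w1 - 1) + c"
    using lift[OF z1] by auto
  obtain w2 where w2: "3 dvd w2 - z2" "3 ^ M dvd (3 ^ s * w2 - 1) ^ 4 + a * (3 ^ s * w2 - 1) ^ 3 + b * (3 ^ s * w2 - 1) + c"
    using lift[OF z2] by auto
  define \<beta>' where "\<beta>' = 3 ^ s' * \<beta>"
  define \<gamma>' where "\<gamma>' = 3 ^ (2 * s') * \<gamma>"
  have b1': "- 4 + 3 * a + b = 27 * \<beta>'" and b0': "1 - a - b + c = 243 * \<gamma>'"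
    unfolding b1 b0 s' \<beta>'_def \<gamma>'_def by (simp_all add: power_add)
  \<comment> \<open>Modulo 3 the second factor is -z^2 (z + 1). The double root 0 belongs to the two
    roots already lifted, and the simple root -1 gives the one near -4.\<close>
  have eq3: "(3 * z - 1) ^ 4 + a * (3 * z - 1) ^ 3 + b * (3 * z - 1) + c
      = 3 ^ 3 * (3 * z ^ 4 + (a - 4) * z ^ 3 + (2 - a) * z ^ 2 + 3 * \<beta>' * z + 9 * \<gamma>')" for z
    unfolding shifted_F b1' b0' by (simp add: algebra_simps eval_nat_numeral)
  have "3 dvd 3 * (- 1) ^ 4 + (a - 4) * (- 1) ^ 3 + (2 - a) * (- 1) ^ 2 + 3 * \<beta>' * (- 1) + 9 * \<gamma>'"
    using a by (simp; presburger)
  moreover have "\<not> 3 dvd 3 * (- 1) ^ 3 + 2 * (2 - a) * (- 1) + 3 * \<beta>'"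
    using a by (simp; presburger)
  ultimately obtain w where w: "3 dvd w - (- 1)"
      "3 ^ M dvd 3 * w ^ 4 + (a - 4) * w ^ 3 + (2 - a) * w ^ 2 + 3 * \<beta>' * w + 9 * \<gamma>'"
    by (rule hensel_quartic)
  have w': "3 ^ M dvd (3 * w - 1) ^ 4 + a * (3 * w - 1) ^ 3 + b * (3 * w - 1) + c"
    by (rule dvd_scaled[OF w(2) eq3])
  obtain a' where a': "a = 3 * a'" using a by blast
  have b_eq: "b = 27 * \<beta>' - 9 * a' + 4"
    using b1' a' by linarith
  have c_eq: "c = 243 * \<gamma>' + 27 * \<beta>' - 6 * a' + 3"
    using b1' b0' a' by linarith
  \<comment> \<open>Modulo 3, \<open>F\<close> is x (x + 1)^3, so the remaining root lies near
    0.\<close>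
  have "3 dvd 1 * 0 ^ 4 + a * 0 ^ 3 + 0 * 0 ^ 2 + b * 0 + c"
    unfolding c_eq by (simp; presburger)
  moreover have "\<not> 3 dvd b"
    unfolding b_eq by presburger
  then have "\<not> 3 dvd 1 * 0 ^ 3 + 2 * 0 * 0 + b" by simp
  ultimately obtain x where x: "3 dvd x - 0" "3 ^ M dvd 1 * x ^ 4 + a * x ^ 3 + 0 * x ^ 2 + b * x + c"
    by (rule hensel_quartic)
  have s3: "(3 :: int) ^ Suc s = 27 * 3 ^ s'" "(3 :: int) ^ s = 9 * 3 ^ s'" by (simp_all add: s')
  have d12: "\<not> 3 ^ Suc s dvd (3 ^ s * w1 - 1) - (3 ^ s * w2 - 1)"
  proof -
    have "\<not> 3 dvd w1 - w2" using w1(1) w2(1) z12 by presburger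
    then show ?thesis using not_pow_3_dvd[of "w1 - w2" s] by (simp add: right_diff_distrib)
  qed
  \<comment> \<open>Modulo 9 the close roots are -1, because \<open>s\<close> is at least 2, whereas
    the isolated one is -4.\<close>
  have dw: "\<not> 3 ^ Suc s dvd (3 ^ s * v - 1) - (3 * w - 1)" for v
  proof
    assume "3 ^ Suc s dvd (3 ^ s * v - 1) - (3 * w - 1)"
    then have "9 dvd (3 ^ s * v - 1) - (3 * w - 1)"
      unfolding s3 by (rule dvd_trans[rotated]) simp
    moreover have "9 dvd 3 ^ s * v" unfolding s3 by simp
    ultimately show False using w(1) by presburger
  qed
  have dx: "\<not> 3 ^ Suc s dvd (3 * v - 1) - x" for v
  proof
    assume "3 ^ Suc s dvd (3 * v - 1) - x"
    then have "3 dvd (3 * v - 1) - x" by (metis dvd_mult_left power_Suc)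
    then show False using x(1) by presburger
  qed
  have dx': "\<not> 3 ^ Suc s dvd (3 ^ s * v - 1) - x" for v
    using dx[of "3 ^ (s - 1) * v"] s by (cases s) (simp_all add: mult.assoc)
  show "\<exists>r0 r1 r2 r3. 3 ^ M dvd r0 ^ 4 + a * r0 ^ 3 + b * r0 + c \<and> 3 ^ M dvd r1 ^ 4 + a * r1 ^ 3 + b * r1 + c \<and>
      3 ^ M dvd r2 ^ 4 + a * r2 ^ 3 + b * r2 + c \<and> 3 ^ M dvd r3 ^ 4 + a * r3 ^ 3 + b * r3 + c \<and>
      \<not> 3 ^ Suc s dvd r0 - r1 \<and> \<not> 3 ^ Suc s dvd r0 - r2 \<and> \<not> 3 ^ Suc s dvd r0 - r3 \<and>
      \<not> 3 ^ Suc s dvd r1 - r2 \<and> \<not> 3 ^ Suc s dvd r1 - r3 \<and> \<not> 3 ^ Suc s dvd r2 - r3"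
    by (intro exI[of _ "3 ^ s * w1 - 1"] exI[of _ "3 ^ s * w2 - 1"] exI[of _ "3 * w - 1"] exI[of _ x] conjI
        w1(2) w2(2) w' d12 dw dx dx') (use x(2) in simp)
qed

text \<open>With \<open>x = 3z - 1\<close>, the factor \<open>(x + 1)\<^sup>3\<close> of \<open>F\<close> modulo 3 becomes \<open>z\<^sup>3 - z\<close>.\<close>
lemma splits_case_4:
  fixes a b c :: int
  assumes a: "3 dvd a - 2" and b1: "27 dvd - 22 + 3 * a + b" and b0: "81 dvd 1 - a - b + c"
  shows "splits_at_3 a b c"
proof (rule splits_at_3I[where B = 1])
  fix M
  \<comment> \<open>As -22 = -4 - 18, the linear coefficient after the shift is 18 modulo 27;
    divided by 9 it is 2, that is -1, modulo 3.\<close>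
  obtain k where "- 22 + 3 * a + b = 27 * k" using b1 by blast
  then obtain \<beta> where \<beta>: "- 4 + 3 * a + b = 9 * \<beta>" "3 dvd \<beta> - 2"
    by (intro that[of "3 * k + 2"]) simp_all
  obtain \<gamma> where \<gamma>: "1 - a - b + c = 81 * \<gamma>" using b0 by blast
  have eq: "(3 * z - 1) ^ 4 + a * (3 * z - 1) ^ 3 + b * (3 * z - 1) + c
      = 3 ^ 3 * (3 * z ^ 4 + (a - 4) * z ^ 3 + (2 - a) * z ^ 2 + \<beta> * z + 3 * \<gamma>)" for z
    unfolding shifted_F \<beta> \<gamma> by (simp add: algebra_simps eval_nat_numeral)
  have lift: "\<exists>z. 3 dvd z - z0 \<and> 3 ^ M dvd (3 * z - 1) ^ 4 + a * (3 * z - 1) ^ 3 + b * (3 * z - 1) + c"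
    if z0: "z0 \<in> {0, 1, - 1}" for z0
  proof -
    have "3 dvd 3 * z0 ^ 4 + (a - 4) * z0 ^ 3 + (2 - a) * z0 ^ 2 + \<beta> * z0 + 3 * \<gamma>"
      using z0 a \<beta>(2) by (auto; presburger)
    moreover have "\<not> 3 dvd 3 * z0 ^ 3 + 2 * (2 - a) * z0 + \<beta>"
      using z0 a \<beta>(2) by (auto; presburger)
    ultimately show ?thesis
      by (rule hensel_quartic[where M = M]) (use dvd_scaled[OF _ eq] in blast)
  qed
  obtain z0 where z0: "3 dvd z0 - 0" "3 ^ M dvd (3 * z0 - 1) ^ 4 + a * (3 * z0 - 1) ^ 3 + b * (3 * z0 - 1) + c"
    using lift[of 0] by auto
  obtain z1 where z1: "3 dvd z1 - 1" "3 ^ M dvd (3 * z1 - 1) ^ 4 + a * (3 * z1 - 1) ^ 3 + b * (3 * z1 - 1) + c"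
    using lift[of 1] by auto
  obtain z2 where z2: "3 dvd z2 - (- 1)" "3 ^ M dvd (3 * z2 - 1) ^ 4 + a * (3 * z2 - 1) ^ 3 + b * (3 * z2 - 1) + c"
    using lift[of "- 1"] by auto
  obtain a' where a': "a = 3 * a' + 2" using a by (metis diff_add_cancel dvdE)
  have b_eq: "b = 9 * \<beta> - 9 * a' - 2"
    using \<beta>(1) a' by linarith
  have sum_eq: "1 + a + b + c = 81 * \<gamma> + 18 * \<beta> - 12 * a'"
    using \<beta>(1) \<gamma> a' by linarith
  \<comment> \<open>Modulo 3, \<open>F\<close> is (x - 1)(x + 1)^3, and the fourth root lies near
    1.\<close>
  have "3 dvd 1 + a + b + c"
    unfolding sum_eq by (intro dvd_add dvd_diff dvd_mult2) simp_all
  then have "3 dvd 1 * 1 ^ 4 + a * 1 ^ 3 + 0 * 1 ^ 2 + b * 1 + c"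
    by simp
  moreover have "\<not> 3 dvd 1 + b"
    unfolding b_eq by presburger
  then have "\<not> 3 dvd 1 * 1 ^ 3 + 2 * 0 * 1 + b" by simp
  ultimately obtain x where x: "3 dvd x - 1" "3 ^ M dvd 1 * x ^ 4 + a * x ^ 3 + 0 * x ^ 2 + b * x + c"
    by (rule hensel_quartic)
  have sq: "(3 :: int) ^ Suc 1 = 9" by simp
  have d: "\<not> 9 dvd (3 * z0 - 1) - (3 * z1 - 1)" "\<not> 9 dvd (3 * z0 - 1) - (3 * z2 - 1)"
    "\<not> 9 dvd (3 * z0 - 1) - x" "\<not> 9 dvd (3 * z1 - 1) - (3 * z2 - 1)"
    "\<not> 9 dvd (3 * z1 - 1) - x" "\<not> 9 dvd (3 * z2 - 1) - x"
    using z0(1) z1(1) z2(1) x(1) by presburger+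
  show "\<exists>r0 r1 r2 r3. 3 ^ M dvd r0 ^ 4 + a * r0 ^ 3 + b * r0 + c \<and> 3 ^ M dvd r1 ^ 4 + a * r1 ^ 3 + b * r1 + c \<and>
      3 ^ M dvd r2 ^ 4 + a * r2 ^ 3 + b * r2 + c \<and> 3 ^ M dvd r3 ^ 4 + a * r3 ^ 3 + b * r3 + c \<and>
      \<not> 3 ^ Suc 1 dvd r0 - r1 \<and> \<not> 3 ^ Suc 1 dvd r0 - r2 \<and> \<not> 3 ^ Suc 1 dvd r0 - r3 \<and>
      \<not> 3 ^ Suc 1 dvd r1 - r2 \<and> \<not> 3 ^ Suc 1 dvd r1 - r3 \<and> \<not> 3 ^ Suc 1 dvd r2 - r3"
    unfolding sq using x(2)
    by (intro exI[of _ "3 * z0 - 1"] exI[of _ "3 * z1 - 1"] exI[of _ "3 * z2 - 1"] exI[of _ x] conjI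
        z0(2) z1(2) z2(2) d) simp
qed

section \<open>Valuations and residue tables\<close>

lemma nu3_decompose:
  assumes "m \<noteq> 0"
  shows "m = 3 ^ nu3 m * part3 m" and "\<not> 3 dvd part3 m"
proof -
  obtain w where w: "m = 3 ^ multiplicity 3 m * w" "\<not> 3 dvd w"
    using multiplicity_decompose'[of m "3 :: int"] assms by auto
  have "part3 m = w"
    unfolding part3_def nu3_def by (subst (1) w(1)) simp
  then show "m = 3 ^ nu3 m * part3 m" "\<not> 3 dvd part3 m"
    using w by (simp_all add: nu3_def)
qed

lemma nu3_geI: "m \<noteq> 0 \<Longrightarrow> 3 ^ n dvd m \<Longrightarrow> n \<le> nu3 m"
  unfolding nu3_def by (subst power_dvd_iff_le_multiplicity[symmetric]) auto

text \<open>The convention \<open>nu3 0 = 0\<close> hides an infinite valuation, so the value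
  \<open>m = 0\<close> is a disjunct of its own, as it is in the hypotheses of the theorem.\<close>

lemma nu3_le_imp_dvd: "m = 0 \<or> n \<le> nu3 m \<Longrightarrow> 3 ^ n dvd m"
  unfolding nu3_def by (auto intro: multiplicity_dvd')

lemma nu3_minus [simp]: "nu3 (- m) = nu3 m"
  by (simp add: nu3_def)

text \<open>The comparison of valuations decides the reduced quadratic -z^2 + \<beta> z + \<gamma>.
  If \<gamma> vanishes modulo 3, its roots are 0 and \<beta>; if \<beta> vanishes, splitting
  requires \<gamma> to be a square, which is the condition on \<open>part3\<close>.\<close>

lemma splits_case_2:
  fixes a b c :: int
  assumes a: "3 dvd a" and b1: "27 dvd - 4 + 3 * a + b" and b0: "243 dvd 1 - a - b + c"
    and val: "(- 4 + 3 * a + b \<noteq> 0 \<and> 2 * nu3 (- 4 + 3 * a + b) < nu3 (1 - a - b + c) + 1)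
      \<or> ((- 4 + 3 * a + b = 0 \<or> 2 * nu3 (- 4 + 3 * a + b) > nu3 (1 - a - b + c) + 1) \<and>
         odd (nu3 (1 - a - b + c)) \<and> [part3 (1 - a - b + c) = 1] (mod 3))"
  shows "splits_at_3 a b c"
proof -
  define m n where "m = - 4 + 3 * a + b" and "n = 1 - a - b + c"
  note val = val[folded m_def n_def]
  have m3: "3 \<le> nu3 m" if "m \<noteq> 0" using nu3_geI[OF that, of 3] b1 by (simp add: m_def)
  \<comment> \<open>For \<open>n = 0\<close> the convention \<open>nu3 n = 0\<close> contradicts
    either alternative: \<open>nu3 m\<close> is at least 3 when \<open>m\<close> is nonzero, and 0
    is not odd.\<close>
  have n0: "n \<noteq> 0"
  proof
    assume "n = 0"
    then have "nu3 n = 0" by (simp add: nu3_def)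
    then show False using val m3 by auto
  qed
  have n5: "5 \<le> nu3 n" using nu3_geI[OF n0, of 5] b0 by (simp add: n_def)
  from val consider "m \<noteq> 0" "2 * nu3 m < nu3 n + 1"
    | "m = 0 \<or> nu3 n + 1 < 2 * nu3 m" "odd (nu3 n)" "[part3 n = 1] (mod 3)"
    by blast
  then show ?thesis
  proof cases
    case 1
    note m0 = 1(1) and lt = 1(2)
    define s where "s = nu3 m - 1"
    \<comment> \<open>The inequality says \<open>nu3 n\<close> is at least \<open>2 * nu3 m\<close>,
      that is \<open>2 * s + 2\<close>, so \<gamma> is a multiple of 3.\<close>
    have "3 ^ (2 * s + 1 + 1) dvd n"
      by (rule nu3_le_imp_dvd) (use lt m3[OF m0] in \<open>auto simp: s_def\<close>)
    then obtain k where k: "n = 3 ^ (2 * s + 1) * (3 * k)" by (auto simp: power_add elim!: dvdE)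
    have m: "m = 3 ^ (s + 1) * part3 m"
      using nu3_decompose(1)[OF m0] m3[OF m0] by (simp add: s_def)
    note p = nu3_decompose(2)[OF m0]
    have f: "2 \<le> s" "- 4 + 3 * a + b = 3 ^ (s + 1) * part3 m"
        "1 - a - b + c = 3 ^ (2 * s + 1) * (3 * k)" "\<not> 3 dvd 0 - part3 m"
        "3 dvd - (0 ^ 2) + part3 m * 0 + 3 * k" "\<not> 3 dvd 0 + part3 m"
        "3 dvd - (part3 m ^ 2) + part3 m * part3 m + 3 * k"
      using m3[OF m0] m k p by (simp_all add: s_def m_def n_def power2_eq_square)
    have "\<not> 3 dvd part3 m + part3 m" using p by presburger
    then show ?thesis by (rule splits_case_2_aux[OF a f])
  next
    case 2
    note mn = 2(1) and p = 2(3)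
    obtain s where s: "nu3 n = 2 * s + 1" using 2(2) by (metis oddE)
    \<comment> \<open>Now \<open>nu3 m\<close>, if \<open>m\<close> is nonzero, is at least
      \<open>s + 2\<close>, so \<beta> is a multiple of 3 and the roots are 1 and -1.\<close>
    have "3 ^ (s + 1 + 1) dvd m"
      by (rule nu3_le_imp_dvd) (use mn s in auto)
    then obtain k where k: "m = 3 ^ (s + 1) * (3 * k)" by (auto simp: power_add elim!: dvdE)
    have n: "n = 3 ^ (2 * s + 1) * part3 n"
      using nu3_decompose(1)[OF n0] s by simp
    have p1: "3 dvd part3 n - 1" using p by (simp add: cong_iff_dvd_diff)
    have f: "2 \<le> s" "- 4 + 3 * a + b = 3 ^ (s + 1) * (3 * k)"
        "1 - a - b + c = 3 ^ (2 * s + 1) * part3 n" "\<not> 3 dvd 1 - (- 1 :: int)"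
      using n5 s n k by (simp_all add: m_def n_def)
    have e: "- (1 ^ 2) + 3 * k * 1 + part3 n = part3 n - 1 + 3 * k"
        "- ((- 1) ^ 2) + 3 * k * - 1 + part3 n = part3 n - 1 + 3 * - k" by simp_all
    have "3 dvd - (1 ^ 2) + 3 * k * 1 + part3 n" "3 dvd - ((- 1) ^ 2) + 3 * k * - 1 + part3 n"
      unfolding e by (intro dvd_add[OF p1] dvd_triv_left)+
    moreover have "\<not> 3 dvd 1 + 3 * k" by presburger
    moreover have "\<not> 3 dvd - 1 + 3 * k" by presburger
    ultimately show ?thesis using splits_case_2_aux[OF a f] by blast
  qed
qed

text \<open>The residue tables enter through linear congruences such as
  \<open>27 dvd - 4 + 3 * a + b\<close>, which can be checked pair by pair.\<close>

lemma dvd_if_residues: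
  fixes a b k l m n d :: int
  assumes "(a mod m, b mod m) \<in> S" and "d dvd m"
    and "\<And>x y. (x, y) \<in> S \<Longrightarrow> d dvd k + n * x + l * y"
  shows "d dvd k + n * a + l * b"
proof -
  have "d dvd a - a mod m" "d dvd b - b mod m"
    using dvd_trans[OF assms(2) dvd_minus_mod] by blast+
  then have "d dvd n * (a - a mod m) + l * (b - b mod m)"
    by simp
  moreover have "d dvd k + n * (a mod m) + l * (b mod m)"
    using assms(1,3) by blast
  ultimately have "d dvd (n * (a - a mod m) + l * (b - b mod m)) + (k + n * (a mod m) + l * (b mod m))"
    by (rule dvd_add)
  then show ?thesis by (simp add: algebra_simps)
qed

theorem theorem2p5:
  fixes a b c :: int and \<alpha> :: complex
  defines "F \<equiv> [:c, b, 0, a, 1:]"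
  assumes irr: "irreducible (map_poly (of_int :: int \<Rightarrow> rat) F)"
    and root: "poly (map_poly of_int F) \<alpha> = 0"
    and cases:
      "(([a = 1] (mod 3) \<or> [a = -1] (mod 3)) \<and> [b = 0] (mod 3) \<and> [c = 0] (mod 3) \<and>
          b \<noteq> 0 \<and> (c = 0 \<or> 3 * nu3 b < 2 * nu3 c) \<and> even (nu3 b) \<and> [part3 b = - a] (mod 3))
       \<or> ((a mod 27, b mod 27) \<in> {(0,4),(3,22),(6,13),(9,4),(12,22),(15,13),(18,4),(21,22),(24,13)} \<and>
          [a + b = 1 + c] (mod 243) \<and>
          ((-4 + 3*a + b \<noteq> 0 \<and> 2 * nu3 (-4 + 3*a + b) < nu3 (1 - a - b + c) + 1)
           \<or> ((-4 + 3*a + b = 0 \<or> 2 * nu3 (-4 + 3*a + b) > nu3 (1 - a - b + c) + 1) \<and>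
              odd (nu3 (1 - a - b + c)) \<and> [part3 (1 - a - b + c) = 1] (mod 3))))
       \<or> ((a mod 243, b mod 243) \<in> {(0,23),(3,14),(6,5),(9,23),(12,14),(15,5),(18,23),(21,14),(24,5)} \<and>
          [a + b = -(1 + c)] (mod 243) \<and>
          ((4 + 3*a + b \<noteq> 0 \<and> 2 * nu3 (4 + 3*a + b) < nu3 (1 + a + b + c) + 1)
           \<or> ((4 + 3*a + b = 0 \<or> 2 * nu3 (4 + 3*a + b) > nu3 (1 + a + b + c) + 1) \<and>
              odd (nu3 (1 + a + b + c)) \<and> [part3 (1 + a + b + c) = 1] (mod 3))))
       \<or> ((a mod 27, b mod 27) \<in> {(2,16),(5,7),(8,25),(11,16),(14,7),(17,25),(20,16),(23,7),(26,25)} \<and>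
          [a + b = c + 1] (mod 81))"
  shows "3 dvd common_index \<alpha> \<and> multiplicity 3 (common_index \<alpha>) = 1 \<and> \<not> monogenic \<alpha>"
proof -
  interpret quartic_root a b c \<alpha>
    using irr root unfolding F_def by (rule quartic_root.intro)
  have "splits_at_3 a b c"
    using cases
  proof (elim disjE)
    assume *: "([a = 1] (mod 3) \<or> [a = -1] (mod 3)) \<and> [b = 0] (mod 3) \<and> [c = 0] (mod 3) \<and>
        b \<noteq> 0 \<and> (c = 0 \<or> 3 * nu3 b < 2 * nu3 c) \<and> even (nu3 b) \<and> [part3 b = - a] (mod 3)"
    then have "[a = 1] (mod 3) \<or> [a = - 1] (mod 3)" by (rule conjunct1)
    then have a: "\<not> 3 dvd a" by (auto simp: cong_def dvd_eq_mod_eq_0)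
    obtain h where h: "nu3 b = 2 * h" using * by blast
    have "1 \<le> nu3 b" using * nu3_geI[of b 1] by (simp add: cong_0_iff)
    then have h1: "h \<ge> 1" using h by simp
    have b: "b = 3 ^ (2 * h) * part3 b" using nu3_decompose(1)[of b] * h by simp
    \<comment> \<open>With \<open>nu3 b = 2 * h\<close> the inequality
      \<open>3 * nu3 b < 2 * nu3 c\<close> becomes \<open>3 * h < nu3 c\<close>.\<close>
    have "3 ^ (3 * h + 1) dvd c"
      by (rule nu3_le_imp_dvd) (use * h in auto)
    then obtain c' where c: "c = 3 ^ (3 * h + 1) * c'" by blast
    have "3 dvd part3 b + a" using * by (simp add: cong_iff_dvd_diff)
    then have "splits_at_3 a (3 ^ (2 * h) * part3 b) (3 ^ (3 * h + 1) * c')"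
      by (rule splits_case_1[OF a h1])
    then show ?thesis using b c by simp
  next
    assume *: "(a mod 27, b mod 27) \<in> {(0,4),(3,22),(6,13),(9,4),(12,22),(15,13),(18,4),(21,22),(24,13)} \<and>
      [a + b = 1 + c] (mod 243) \<and>
      ((-4 + 3*a + b \<noteq> 0 \<and> 2 * nu3 (-4 + 3*a + b) < nu3 (1 - a - b + c) + 1)
       \<or> ((-4 + 3*a + b = 0 \<or> 2 * nu3 (-4 + 3*a + b) > nu3 (1 - a - b + c) + 1) \<and>
          odd (nu3 (1 - a - b + c)) \<and> [part3 (1 - a - b + c) = 1] (mod 3)))"
    then have ab: "(a mod 27, b mod 27) \<in> {(0,4),(3,22),(6,13),(9,4),(12,22),(15,13),(18,4),(21,22),(24,13)}"
      by (rule conjunct1)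
    have "3 dvd 0 + 1 * a + 0 * b" "27 dvd - 4 + 3 * a + 1 * b"
      by (rule dvd_if_residues[OF ab]; auto)+
    moreover have "243 dvd 1 - a - b + c"
    proof -
      have "243 dvd (1 + c) - (a + b)" using * by (simp add: cong_iff_dvd_diff dvd_diff_commute)
      then show ?thesis by (simp add: algebra_simps)
    qed
    ultimately show ?thesis using * by (intro splits_case_2) simp_all
  next
    assume *: "(a mod 243, b mod 243) \<in> {(0,23),(3,14),(6,5),(9,23),(12,14),(15,5),(18,23),(21,14),(24,5)} \<and>
      [a + b = -(1 + c)] (mod 243) \<and>
      ((4 + 3*a + b \<noteq> 0 \<and> 2 * nu3 (4 + 3*a + b) < nu3 (1 + a + b + c) + 1)
       \<or> ((4 + 3*a + b = 0 \<or> 2 * nu3 (4 + 3*a + b) > nu3 (1 + a + b + c) + 1) \<and>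
          odd (nu3 (1 + a + b + c)) \<and> [part3 (1 + a + b + c) = 1] (mod 3)))"
    then have ab: "(a mod 243, b mod 243) \<in> {(0,23),(3,14),(6,5),(9,23),(12,14),(15,5),(18,23),(21,14),(24,5)}"
      by (rule conjunct1)
    have "3 dvd 0 + 1 * a + 0 * b" "27 dvd 4 + 3 * a + 1 * b"
      by (rule dvd_if_residues[OF ab]; auto)+
    moreover have "243 dvd 1 + a + b + c"
    proof -
      have "243 dvd (a + b) - - (1 + c)" using * by (simp only: cong_iff_dvd_diff)
      then show ?thesis by (simp add: algebra_simps)
    qed
    \<comment> \<open>Under the change of signs the linear coefficient only changes sign, which
      \<open>nu3\<close> ignores, and the constant term becomes exactly
      \<open>1 + a + b + c\<close>, so the condition on its \<open>part3\<close> carries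
      over.\<close>
    moreover have m: "- 4 + 3 * - a + - b = - (4 + 3 * a + b)" by simp
    moreover have n: "1 - - a - - b + c = 1 + a + b + c" by simp
    ultimately have "splits_at_3 (- a) (- b) c"
      using * by (intro splits_case_2) (simp_all only: m n nu3_minus dvd_minus_iff neg_equal_0_iff_equal, auto)
    then show ?thesis by (rule splits_at_3_uminus)
  next
    assume *: "(a mod 27, b mod 27) \<in> {(2,16),(5,7),(8,25),(11,16),(14,7),(17,25),(20,16),(23,7),(26,25)} \<and>
      [a + b = c + 1] (mod 81)"
    then have ab: "(a mod 27, b mod 27) \<in> {(2,16),(5,7),(8,25),(11,16),(14,7),(17,25),(20,16),(23,7),(26,25)}"
      by (rule conjunct1)
    have "3 dvd - 2 + 1 * a + 0 * b" "27 dvd - 22 + 3 * a + 1 * b"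
      by (rule dvd_if_residues[OF ab]; auto)+
    moreover have "81 dvd 1 - a - b + c"
    proof -
      have "81 dvd (c + 1) - (a + b)" using * by (simp add: cong_iff_dvd_diff dvd_diff_commute)
      then show ?thesis by (simp add: algebra_simps)
    qed
    ultimately show ?thesis by (intro splits_case_4) simp_all
  qed
  then obtain B where "\<And>M. \<exists>r :: nat \<Rightarrow> int. (\<forall>i<4. 3 ^ M dvd poly [:c, b, 0, a, 1:] (r i)) \<and>
      (\<forall>i<4. \<forall>j<4. i \<noteq> j \<longrightarrow> \<not> 3 ^ Suc B dvd r i - r j)"
    unfolding splits_at_3_def by blast
  then show ?thesis by (rule common_index_if_splits)
qed

end
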